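(* There exists a computable map $f:[0,1]\to[0,1]$ with a $\Pi_2$-complete metric attractor $\mathcal A\subset[0,1]$ (with respect to Lebesgue measure on $[0,1]$).
   Context: **Computability.** On $[0,1]$ with its usual metric, the ideal points are the rationals of $[0,1]$ and the ideal balls are the open balls of $[0,1]$ with ideal center and positive rational radius; $(B_i)_{i\in\mathbb N}$ is a fixed computable enumeration of them and $\overline{B_i}$ is the closed ball with the same center and radius. A map $f:[0,1]\to[0,1]$ is computable if there is an algorithm which, given $m$, enumerates a set $I_m\subset\mathbb N$ with $f^{-1}(B_m)=\bigcup_{i\in I_m}B_i$. **Complexity of closed sets.** A compact set $K$ is $\Pi_n$ if its outer collection $\{i:\overline{B_i}\cap K=\emptyset\}$ is a $\Sigma_n$ set of integers (arithmetical hierarchy). $K$ is $\Pi_n$-complete if it is $\Pi_n$ and any other $\Pi_n$ compact set $K'$ can be reduced to $K$, in the sense that, provided with an enumeration of the outer collection of $K$, we can (algorithmically) enumerate the outer collection of $K'$. **Metric attractor.** Let $\lambda$ be Lebesgue measure. $\omega(x)$ is the set of accumulation points of $x,f(x),f^2(x),\dots$. For a closed set $A$, $\rho(A)=\{x:\omega(x)\subset A\}$. A closed set $A$ is a metric attractor if $\rho(A)$ has full $\lambda$-measure and no strictly smaller closed $A'\subset A$ has $\lambda(\rho(A'))>0$. *)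

theory Defs
  imports "HOL-Analysis.Analysis" "HOL-Library.Nat_Bijection"
begin

section \<open>Partial recursive functions relative to a function parameter\<close>

datatype recf =
    Zero
  | Succ
  | Proj nat
  | Query
  | Comp recf "recf list"
  | PrimRec recf recf
  | Mu recf

text \<open>
  \<open>eval e p xs\<close> is the result of running \<open>p\<close> on \<open>xs\<close>, where \<open>Query\<close> looks up
  values of \<open>e\<close>; \<open>None\<close> means divergence. Arities are not tracked: on inputs
  of a fixed length every subprogram is only called on inputs of a fixed length.
\<close>

fun eval :: "(nat \<Rightarrow> nat) \<Rightarrow> recf \<Rightarrow> nat list \<Rightarrow> nat option" where
  "eval e Zero xs = Some 0"
| "eval e Succ xs = (case xs of [] \<Rightarrow> None | x # _ \<Rightarrow> Some (Suc x))"
| "eval e (Proj i) xs = (if i < length xs then Some (xs ! i) else None)"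
| "eval e Query xs = (case xs of [] \<Rightarrow> None | x # _ \<Rightarrow> Some (e x))"
| "eval e (Comp f gs) xs =
     (if \<forall>g\<in>set gs. eval e g xs \<noteq> None
      then eval e f (map (\<lambda>g. the (eval e g xs)) gs) else None)"
| "eval e (PrimRec f g) xs =
     (case xs of [] \<Rightarrow> None
      | n # ys \<Rightarrow>
          rec_nat (eval e f ys) (\<lambda>k r. Option.bind r (\<lambda>v. eval e g (k # v # ys))) n)"
| "eval e (Mu f) xs =
     (if \<exists>y. eval e f (y # xs) = Some 0 \<and> (\<forall>z<y. eval e f (z # xs) \<noteq> None)
      then Some (LEAST y. eval e f (y # xs) = Some 0) else None)"

text \<open>Unrelativized computation uses the constant function 0, which adds no computing power.\<close>

abbreviation run :: "recf \<Rightarrow> nat list \<Rightarrow> nat option" where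
  "run \<equiv> eval (\<lambda>_. 0)"

text \<open>
  An enumeration may output nothing at a step: the value \<open>0\<close> is a pause, and
  \<open>Suc i\<close> outputs \<open>i\<close>. In particular the empty set has enumerations.
\<close>

definition enumeration_of :: "(nat \<Rightarrow> nat) \<Rightarrow> nat set \<Rightarrow> bool" where
  "enumeration_of g S \<longleftrightarrow> S = {i. \<exists>n. g n = Suc i}"

definition enumerates :: "(nat \<Rightarrow> nat) \<Rightarrow> recf \<Rightarrow> nat list \<Rightarrow> nat set \<Rightarrow> bool" where
  "enumerates e p xs S \<longleftrightarrow>
     (\<exists>g. enumeration_of g S \<and> (\<forall>n. eval e p (n # xs) = Some (g n)))"


section \<open>Arithmetical hierarchy\<close>

definition decidable_rel :: "nat \<Rightarrow> nat list set \<Rightarrow> bool" where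
  "decidable_rel k R \<longleftrightarrow>
     (\<exists>p. \<forall>xs. length xs = k \<longrightarrow> run p xs = Some (if xs \<in> R then 1 else 0))"

text \<open>Only the tuples of length \<open>k\<close> in \<open>R\<close> matter for \<open>Sigma_rel n k R\<close> and \<open>Pi_rel n k R\<close>.\<close>

fun Sigma_rel :: "nat \<Rightarrow> nat \<Rightarrow> nat list set \<Rightarrow> bool"
  and Pi_rel :: "nat \<Rightarrow> nat \<Rightarrow> nat list set \<Rightarrow> bool" where
  "Sigma_rel 0 k R \<longleftrightarrow> decidable_rel k R"
| "Sigma_rel (Suc n) k R \<longleftrightarrow>
     (\<exists>Q. Pi_rel n (Suc k) Q \<and> (\<forall>xs. length xs = k \<longrightarrow> (xs \<in> R \<longleftrightarrow> (\<exists>y. y # xs \<in> Q))))"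
| "Pi_rel 0 k R \<longleftrightarrow> decidable_rel k R"
| "Pi_rel (Suc n) k R \<longleftrightarrow>
     (\<exists>Q. Sigma_rel n (Suc k) Q \<and> (\<forall>xs. length xs = k \<longrightarrow> (xs \<in> R \<longleftrightarrow> (\<forall>y. y # xs \<in> Q))))"

definition Sigma_set :: "nat \<Rightarrow> nat set \<Rightarrow> bool" where
  "Sigma_set n S \<longleftrightarrow> Sigma_rel n 1 {[i] | i. i \<in> S}"


section \<open>Ideal balls and computable maps of the unit interval\<close>

definition ideal_center :: "nat \<Rightarrow> real" where
  "ideal_center i =
     (case prod_decode (fst (prod_decode i)) of (a, b) \<Rightarrow> min 1 (real a / real (Suc b)))"

definition ideal_radius :: "nat \<Rightarrow> real" where
  "ideal_radius i =
     (case prod_decode (snd (prod_decode i)) of (a, b) \<Rightarrow> real (Suc a) / real (Suc b))"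

definition ideal_ball :: "nat \<Rightarrow> real set" where
  "ideal_ball i = ball (ideal_center i) (ideal_radius i) \<inter> {0..1}"

definition ideal_cball :: "nat \<Rightarrow> real set" where
  "ideal_cball i = cball (ideal_center i) (ideal_radius i) \<inter> {0..1}"

lemma nonneg_rat_cases:
  assumes "q \<in> \<rat>" "q \<ge> (0::real)"
  obtains a b where "q = real a / real (Suc b)"
proof -
  obtain m n where "n \<noteq> 0" and q: "\<bar>q\<bar> = real m / real n"
    using Rats_abs_nat_div_natE[OF assms(1)] by blast
  then have "q = real m / real (Suc (n - 1))"
    using assms(2) by simp
  then show thesis by (rule that)
qed

lemma range_ideal_center_radius:
  "range (\<lambda>i. (ideal_center i, ideal_radius i)) = (\<rat> \<inter> {0..1}) \<times> (\<rat> \<inter> {0<..})"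
proof (rule set_eqI, safe)
  fix i
  show "ideal_center i \<in> \<rat>"
    by (auto simp: ideal_center_def min_def split: prod.split)
  show "ideal_center i \<in> {0..1}"
    by (auto simp: ideal_center_def min_def split: prod.split)
  show "ideal_radius i \<in> \<rat>"
    by (auto simp: ideal_radius_def simp del: of_nat_Suc split: prod.split)
  show "0 < ideal_radius i"
    by (auto simp: ideal_radius_def simp del: of_nat_Suc split: prod.split)
next
  fix c r :: real
  assume c: "c \<in> \<rat>" "c \<in> {0..1}" and r: "r \<in> \<rat>" "0 < r"
  obtain a b where ab: "c = real a / real (Suc b)"
    using nonneg_rat_cases[of c] c by auto
  obtain a' b' where ab': "r = real a' / real (Suc b')"
    using nonneg_rat_cases[of r] r by auto
  with r(2) obtain a'' where a'': "a' = Suc a''"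
    by (cases a') auto
  define i where "i = prod_encode (prod_encode (a, b), prod_encode (a'', b'))"
  have "ideal_center i = c"
    using c(2) by (simp add: ideal_center_def i_def ab del: of_nat_Suc)
  moreover have "ideal_radius i = r"
    by (simp add: ideal_radius_def i_def ab' a'' del: of_nat_Suc)
  ultimately show "(c, r) \<in> range (\<lambda>i. (ideal_center i, ideal_radius i))"
    by (intro image_eqI[where x = i]) auto
qed

text \<open>The values of \<open>f\<close> outside the unit interval are irrelevant.\<close>

definition computable_map :: "(real \<Rightarrow> real) \<Rightarrow> bool" where
  "computable_map f \<longleftrightarrow>
     f \<in> {0..1} \<rightarrow> {0..1} \<and>
     (\<exists>p. \<forall>m. \<exists>I. enumerates (\<lambda>_. 0) p [m] I \<and>
        {x \<in> {0..1}. f x \<in> ideal_ball m} = (\<Union>i\<in>I. ideal_ball i))"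


section \<open>Complexity of compact subsets of the unit interval\<close>

definition outer_collection :: "real set \<Rightarrow> nat set" where
  "outer_collection K = {i. ideal_cball i \<inter> K = {}}"

definition Pi_compact :: "nat \<Rightarrow> real set \<Rightarrow> bool" where
  "Pi_compact n K \<longleftrightarrow> compact K \<and> K \<subseteq> {0..1} \<and> Sigma_set n (outer_collection K)"

definition outer_reducible :: "real set \<Rightarrow> real set \<Rightarrow> bool" where
  "outer_reducible K' K \<longleftrightarrow>
     (\<exists>p. \<forall>e. enumeration_of e (outer_collection K) \<longrightarrow>
        enumerates e p [] (outer_collection K'))"

definition Pi_complete :: "nat \<Rightarrow> real set \<Rightarrow> bool" where
  "Pi_complete n K \<longleftrightarrow> Pi_compact n K \<and> (\<forall>K'. Pi_compact n K' \<longrightarrow> outer_reducible K' K)"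


section \<open>Metric attractors\<close>

text \<open>Accumulation points of the orbit as a sequence, so that periodic points are included.\<close>

definition omega_limit :: "(real \<Rightarrow> real) \<Rightarrow> real \<Rightarrow> real set" where
  "omega_limit f x = {y. \<forall>U. open U \<longrightarrow> y \<in> U \<longrightarrow> infinite {n. (f ^^ n) x \<in> U}}"

definition basin :: "(real \<Rightarrow> real) \<Rightarrow> real set \<Rightarrow> real set" where
  "basin f A = {x \<in> {0..1}. omega_limit f x \<subseteq> A}"

text \<open>
  For continuous self-maps \<open>f\<close> of the unit interval, hence for computable ones, and closed \<open>A\<close>
  the set \<open>basin f A\<close> is Borel, so \<open>emeasure\<close> is meaningful on it.
\<close>

definition metric_attractor :: "(real \<Rightarrow> real) \<Rightarrow> real set \<Rightarrow> bool" where
  "metric_attractor f A \<longleftrightarrow>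
     closed A \<and> A \<subseteq> {0..1} \<and>
     emeasure (lebesgue_on {0..1}) (basin f A) = 1 \<and>
     \<not> (\<exists>A'. closed A' \<and> A' \<subset> A \<and> emeasure (lebesgue_on {0..1}) (basin f A') > 0)"

end

theory Submission
  imports Defs
begin

text \<open>
  Let \<open>f\<^sub>z x = min {1, 2 x, 16 \<bar>x - 3/4\<bar>, z + 16 (1 - x)}\<close> on the unit interval. The points that never
  reach \<open>1\<close> form a set covered by four affine copies of itself of total scale \<open>11/16\<close>, hence a null
  set, so almost every point has the limit set \<open>A\<close> of \<open>1\<close>, which is therefore the metric attractor.
  Since \<open>f\<^sub>z 1 = z\<close>, everything is governed by the orbit of \<open>z\<close>. Near the preimage \<open>3/4\<close> of the
  repelling fixed point \<open>0\<close>, a point \<open>3/4 - 2\<^sup>-\<^sup>k\<^sup>-\<^sup>4 y\<close> with \<open>y\<close> close to \<open>3/4\<close> is mapped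
  to \<open>2\<^sup>-\<^sup>k y\<close>, doubles up to \<open>y\<close>, and is then sent to a tiny number that doubles up to the next
  such point. Hence a computable \<open>z\<close> can be chosen whose orbit passes close to the points
  \<open>3/4 - 2\<^sup>-\<^sup>k\<^sup>-\<^sup>4 (3/4)\<close> in the order prescribed by any computable sequence of indices \<open>k\<close>; such a
  point lies in \<open>A\<close> iff its index occurs infinitely often. A universal \<open>\<Sigma>\<^sub>2\<close> set is the set of
  indices occurring finitely often in a suitable computable sequence, which makes \<open>A\<close> complete.
  Conversely \<open>A\<close> is \<open>\<Pi>\<^sub>2\<close>, being the limit set of a uniformly computable sequence of reals.
\<close>

section \<open>Computable functions on coded types\<close>

definition pred_prog :: recf where "pred_prog = PrimRec Zero (Proj 0)"
definition add_prog :: recf where "add_prog = PrimRec (Proj 0) (Comp Succ [Proj 1])"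
text \<open>\<open>PrimRec\<close> recurses on the first input, so the subtrahend comes first and
  callers list it before the minuend.\<close>

definition sub_prog :: recf where "sub_prog = PrimRec (Proj 0) (Comp pred_prog [Proj 1])"
definition triangle_prog :: recf where
  "triangle_prog = PrimRec Zero (Comp add_prog [Comp Succ [Proj 0], Proj 1])"
definition pair_prog :: recf where
  "pair_prog = Comp add_prog [Comp triangle_prog [add_prog], Proj 0]"
text \<open>The code of \<open>(m, n)\<close> is at least \<open>triangle (m + n)\<close> and below
  \<open>triangle (Suc (m + n))\<close>, so an unbounded search recovers the diagonal
  \<open>m + n\<close>. A vanishing truncated difference expresses the strict inequality.\<close>

definition diag_prog :: recf where
  "diag_prog = Mu (Comp sub_prog [Comp triangle_prog [Comp Succ [Proj 0]], Comp Succ [Proj 1]])"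
definition fst_prog :: recf where
  "fst_prog = Comp sub_prog [Comp triangle_prog [diag_prog], Proj 0]"
definition snd_prog :: recf where "snd_prog = Comp sub_prog [fst_prog, diag_prog]"

lemma eval_pred_prog [simp]: "eval e pred_prog [n] = Some (n - 1)"
  unfolding pred_prog_def by (induction n) auto

lemma eval_add_prog [simp]: "eval e add_prog [a, b] = Some (a + b)"
  unfolding add_prog_def by (induction a) auto

lemma eval_sub_prog [simp]: "eval e sub_prog [a, b] = Some (b - a)"
  unfolding sub_prog_def by (induction a) auto

lemma eval_triangle_prog [simp]: "eval e triangle_prog [n] = Some (triangle n)"
  unfolding triangle_prog_def by (induction n) auto

lemma eval_pair_prog [simp]: "eval e pair_prog [a, b] = Some (prod_encode (a, b))"
  unfolding pair_prog_def by (simp add: prod_encode_def)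

lemma triangle_mono: "m \<le> n \<Longrightarrow> triangle m \<le> triangle n"
  by (induction n) (auto simp: le_Suc_eq)

lemma Least_triangle: "(LEAST k. prod_encode (m, n) < triangle (Suc k)) = m + n"
proof (rule Least_equality)
  show "prod_encode (m, n) < triangle (Suc (m + n))"
    by (simp add: prod_encode_def)
next
  fix k assume "prod_encode (m, n) < triangle (Suc k)"
  then have "triangle (m + n) < triangle (Suc k)"
    by (simp add: prod_encode_def)
  then have "\<not> Suc k \<le> m + n"
    using triangle_mono linorder_not_less by blast
  then show "m + n \<le> k" by simp
qed

lemma eval_diag_prog [simp]: "eval e diag_prog [prod_encode (m, n)] = Some (m + n)"
proof -
  have eq: "(Suc c - triangle (Suc k) = 0) = (c < triangle (Suc k))" for c k by auto
  have "prod_encode (m, n) < triangle (Suc (m + n))"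
    by (simp add: prod_encode_def)
  then have "\<exists>k. prod_encode (m, n) < triangle (Suc k)" ..
  then show ?thesis
    unfolding diag_prog_def
    by (simp add: eq Least_triangle Suc_le_eq del: triangle_Suc)
qed

lemma eval_fst_prog [simp]: "eval e fst_prog [c] = Some (fst (prod_decode c))"
proof -
  obtain m n where c: "c = prod_encode (m, n)" by (metis prod_decode_inverse surj_pair)
  have "prod_encode (m, n) - triangle (m + n) = m" by (simp add: prod_encode_def)
  then show ?thesis unfolding fst_prog_def c by simp
qed

lemma eval_snd_prog [simp]: "eval e snd_prog [c] = Some (snd (prod_decode c))"
proof -
  obtain m n where c: "c = prod_encode (m, n)" by (metis prod_decode_inverse surj_pair)
  show ?thesis unfolding snd_prog_def c by simp
qed

class coded =
  fixes enc :: "'a \<Rightarrow> nat"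
  assumes bij_enc: "bij enc"
begin

text \<open>Because \<open>enc\<close> is a bijection and not merely an injection,
  \<open>dec\<close> reads every number as a code, and searches over numbers need no test for
  well-formed codes.\<close>

definition dec :: "nat \<Rightarrow> 'a" where "dec = inv enc"

lemma enc_dec [simp]: "enc (dec n) = n"
  by (simp add: bij_enc bij_is_surj dec_def surj_f_inv_f)

lemma dec_enc [simp]: "dec (enc x) = x"
  by (simp add: bij_enc bij_is_inj dec_def)

lemma enc_eq_iff [simp]: "enc x = enc y \<longleftrightarrow> x = y"
  by (metis dec_enc)

end

instantiation nat :: coded
begin
definition enc_nat :: "nat \<Rightarrow> nat" where enc_nat_eq [simp]: "enc_nat n = n"
instance by standard (simp add: bij_def inj_def surj_def)
end

instantiation prod :: (coded, coded) coded
begin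
definition enc_prod :: "'a \<times> 'b \<Rightarrow> nat" where
  "enc_prod p = prod_encode (enc (fst p), enc (snd p))"
instance
proof
  have "\<exists>p::'a \<times> 'b. n = enc p" for n
    by (rule exI[of _ "(dec (fst (prod_decode n)), dec (snd (prod_decode n)))"])
       (simp add: enc_prod_def)
  then show "bij (enc :: 'a \<times> 'b \<Rightarrow> nat)"
    by (auto simp: bij_def inj_def surj_def enc_prod_def)
qed
end

instantiation list :: (coded) coded
begin
definition enc_list :: "'a list \<Rightarrow> nat" where
  "enc_list xs = list_encode (map enc xs)"
instance
proof
  have "\<exists>xs::'a list. n = enc xs" for n
    by (rule exI[of _ "map dec (list_decode n)"]) (simp add: enc_list_def o_def)
  moreover have "inj (enc :: 'a list \<Rightarrow> nat)"
    by (auto simp: inj_def enc_list_def list_encode_eq inj_map_eq_map bij_enc bij_is_inj)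
  ultimately show "bij (enc :: 'a list \<Rightarrow> nat)"
    by (auto simp: bij_def surj_def)
qed
end

lemma enc_Pair [simp]: "enc (a, b) = prod_encode (enc a, enc b)"
  by (simp add: enc_prod_def)

lemma enc_Nil [simp]: "enc [] = 0"
  by (simp add: enc_list_def)

lemma enc_Cons [simp]: "enc (x # xs) = Suc (prod_encode (enc x, enc xs))"
  by (simp add: enc_list_def)

text \<open>One program must work under every oracle. The same closure properties then serve both
  plain runs and the reductions that query an enumeration.\<close>

definition computable :: "('a::coded \<Rightarrow> 'b::coded) \<Rightarrow> bool" where
  "computable F \<longleftrightarrow> (\<exists>p. \<forall>e x. eval e p [enc x] = Some (enc (F x)))"

lemma computableI: "(\<And>e x. eval e p [enc x] = Some (enc (F x))) \<Longrightarrow> computable F"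
  by (auto simp: computable_def)

lemma computableE:
  assumes "computable F"
  obtains p where "\<And>e x. eval e p [enc x] = Some (enc (F x))"
  using assms by (auto simp: computable_def)

lemma computable_id: "computable (\<lambda>x. x)"
  by (rule computableI[of "Proj 0"]) simp

lemma computable_const: "computable (\<lambda>x. c)"
proof -
  have "\<exists>p. \<forall>e xs. eval e p xs = Some n" for n
  proof (induction n)
    case 0
    show ?case by (rule exI[of _ Zero]) simp
  next
    case (Suc n)
    then obtain p where "\<forall>e xs. eval e p xs = Some n" by blast
    then show ?case by (intro exI[of _ "Comp Succ [p]"]) simp
  qed
  then show ?thesis by (metis computableI)
qed

lemma computable_compose:
  assumes "computable F" "computable G"
  shows "computable (\<lambda>x. F (G x))"
proof -
  obtain p q where "\<And>e x. eval e p [enc x] = Some (enc (F x))"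
    and "\<And>e x. eval e q [enc x] = Some (enc (G x))"
    using assms by (metis computableE)
  then show ?thesis by (intro computableI[of "Comp p [q]"]) simp
qed

lemma computable_Pair:
  assumes "computable F" "computable G"
  shows "computable (\<lambda>x. (F x, G x))"
proof -
  obtain p q where "\<And>e x. eval e p [enc x] = Some (enc (F x))"
    and "\<And>e x. eval e q [enc x] = Some (enc (G x))"
    using assms by (metis computableE)
  then show ?thesis by (intro computableI[of "Comp pair_prog [p, q]"]) simp
qed

lemma computable_fst_nat: "computable (\<lambda>c. fst (prod_decode c))"
  by (rule computableI[of fst_prog]) simp

lemma computable_snd_nat: "computable (\<lambda>c. snd (prod_decode c))"
  by (rule computableI[of snd_prog]) simp

lemma computable_fst: "computable F \<Longrightarrow> computable (\<lambda>x. fst (F x))"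
  by (rule computable_compose[of fst]) (auto intro!: computableI[of fst_prog] simp: enc_prod_def)

lemma computable_snd: "computable F \<Longrightarrow> computable (\<lambda>x. snd (F x))"
  by (rule computable_compose[of snd]) (auto intro!: computableI[of snd_prog] simp: enc_prod_def)

lemma computable_Suc: "computable F \<Longrightarrow> computable (\<lambda>x. Suc (F x))"
  by (rule computable_compose[of Suc]) (auto intro!: computableI[of Succ])

lemma computable_enc: "computable F \<Longrightarrow> computable (\<lambda>x. enc (F x))"
  unfolding computable_def by simp

lemma computable_dec: "computable F \<Longrightarrow> computable (\<lambda>x. dec (F x))"
  unfolding computable_def by simp

lemma computable_rec_nat:
  assumes "computable N" "computable A" "computable (\<lambda>t. H (fst t) (fst (snd t)) (snd (snd t)))"
  shows "computable (\<lambda>x. rec_nat (A x) (\<lambda>n v. H n v x) (N x))"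
proof -
  obtain p where p: "\<And>e x. eval e p [enc x] = Some (enc (N x))"
    using assms(1) unfolding computable_def by blast
  obtain q where q: "\<And>e x. eval e q [enc x] = Some (enc (A x))"
    using assms(2) unfolding computable_def by blast
  obtain r where "\<And>e t. eval e r [enc t] = Some (enc (H (fst t) (fst (snd t)) (snd (snd t))))"
    using assms(3) unfolding computable_def by blast
  from this[of _ "(n, v, x)" for n v x]
  have r: "\<And>e n v x. eval e r [prod_encode (n, prod_encode (enc v, enc x))] = Some (enc (H n v x))"
    by simp
  \<comment> \<open>\<open>PrimRec\<close> passes counter, value and parameter as three separate
    inputs, while \<open>r\<close> expects the code of the triple.\<close>
  define s where "s = Comp r [Comp pair_prog [Proj 0, Comp pair_prog [Proj 1, Proj 2]]]"
  have s: "eval e s [n, enc v, enc x] = Some (enc (H n v x))" for e n v x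
    unfolding s_def by (simp add: r)
  have "rec_nat (eval e q [enc x]) (\<lambda>k r. Option.bind r (\<lambda>v. eval e s (k # v # [enc x]))) n =
    Some (enc (rec_nat (A x) (\<lambda>n v. H n v x) n))" for e x n
    by (induction n) (auto simp: q s)
  then show ?thesis
    by (intro computableI[of "Comp (PrimRec q s) [p, Proj 0]"]) (simp add: p)
qed

lemma computable_rec_nat':
  assumes "computable N" "computable A" "computable (\<lambda>t. H (fst t) (fst (snd t)) (snd (snd t)))"
    and "\<And>x. F x = rec_nat (A x) (\<lambda>n v. H n v x) (N x)"
  shows "computable F"
proof -
  have "F = (\<lambda>x. rec_nat (A x) (\<lambda>n v. H n v x) (N x))" by (rule ext) (rule assms(4))
  with computable_rec_nat[OF assms(1-3)] show ?thesis by (rule ssubst[rotated])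
qed

lemma computable_add:
  fixes F G :: "'a::coded \<Rightarrow> nat"
  assumes "computable F" "computable G"
  shows "computable (\<lambda>x. F x + G x)"
proof -
  have "computable (\<lambda>t::nat \<times> nat. fst t + snd t)"
    by (intro computableI[of "Comp add_prog [fst_prog, snd_prog]"]) (simp add: enc_prod_def)
  from computable_compose[OF this computable_Pair[OF assms]] show ?thesis by simp
qed

lemma computable_diff:
  fixes F G :: "'a::coded \<Rightarrow> nat"
  assumes "computable F" "computable G"
  shows "computable (\<lambda>x. F x - G x)"
proof -
  have "computable (\<lambda>t::nat \<times> nat. fst t - snd t)"
    by (intro computableI[of "Comp sub_prog [snd_prog, fst_prog]"]) (simp add: enc_prod_def)
  from computable_compose[OF this computable_Pair[OF assms]] show ?thesis by simp
qed

lemma computable_mult: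
  fixes F G :: "'a::coded \<Rightarrow> nat"
  assumes "computable F" "computable G"
  shows "computable (\<lambda>x. F x * G x)"
proof (rule computable_rec_nat'[OF assms(1) computable_const[of 0], where H = "\<lambda>n v x. v + G x"])
  show "computable (\<lambda>t::nat \<times> nat \<times> 'a. fst (snd t) + G (snd (snd t)))"
    by (intro computable_add computable_compose[OF assms(2)] computable_fst computable_snd computable_id)
  show "F x * G x = rec_nat 0 (\<lambda>n v. v + G x) (F x)" for x
  proof -
    have "n * G x = rec_nat 0 (\<lambda>n v. v + G x) n" for n by (induction n) auto
    then show ?thesis .
  qed
qed

section \<open>Decidable predicates and branching\<close>

definition decidable :: "('a::coded \<Rightarrow> bool) \<Rightarrow> bool" where
  "decidable P \<longleftrightarrow> computable (\<lambda>x. of_bool (P x) :: nat)"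

lemma computable_of_bool: "decidable P \<Longrightarrow> computable (\<lambda>x. of_bool (P x) :: nat)"
  by (simp add: decidable_def)

lemma decidable_compose: "decidable P \<Longrightarrow> computable G \<Longrightarrow> decidable (\<lambda>x. P (G x))"
  unfolding decidable_def by (rule computable_compose)

text \<open>Branching is a recursion of zero or one steps: zero steps leave \<open>G x\<close>, one
  step overwrites it by \<open>F x\<close>.\<close>

lemma computable_if:
  assumes "decidable P" "computable F" "computable G"
  shows "computable (\<lambda>x. if P x then F x else G x)"
proof (rule computable_rec_nat'[where N = "\<lambda>x. of_bool (P x)" and A = G and H = "\<lambda>n v x. F x"])
  show "computable (\<lambda>x. of_bool (P x) :: nat)"
    using assms(1) by (rule computable_of_bool)
  show "computable (\<lambda>t::nat \<times> 'b \<times> 'a. F (snd (snd t)))"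
    by (intro computable_compose[OF assms(2)] computable_snd computable_id)
qed (use assms in auto)

lemma decidable_const: "decidable (\<lambda>x. b)"
  unfolding decidable_def by (rule computable_const)

lemma decidable_if:
  assumes "decidable P" "decidable Q" "decidable R"
  shows "decidable (\<lambda>x. if P x then Q x else R x)"
  using computable_if[OF assms(1) assms(2,3)[unfolded decidable_def]]
  by (simp add: decidable_def if_distrib)

lemma decidable_cong: "decidable P \<Longrightarrow> (\<And>x. P x = Q x) \<Longrightarrow> decidable Q"
  by (rule subst[of P Q decidable]) auto

lemma decidable_not:
  assumes "decidable P"
  shows "decidable (\<lambda>x. \<not> P x)"
  by (rule decidable_cong[OF decidable_if[OF assms decidable_const[of False] decidable_const[of True]]])
    auto

lemma decidable_conj:
  assumes "decidable P" "decidable Q"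
  shows "decidable (\<lambda>x. P x \<and> Q x)"
  by (rule decidable_cong[OF decidable_if[OF assms decidable_const[of False]]]) auto

lemma decidable_disj:
  assumes "decidable P" "decidable Q"
  shows "decidable (\<lambda>x. P x \<or> Q x)"
  by (rule decidable_cong[OF decidable_if[OF assms(1) decidable_const[of True] assms(2)]]) auto

lemma decidable_imp:
  assumes "decidable P" "decidable Q"
  shows "decidable (\<lambda>x. P x \<longrightarrow> Q x)"
  by (rule decidable_cong[OF decidable_if[OF assms decidable_const[of True]]]) auto

lemma decidable_less:
  fixes F G :: "'a::coded \<Rightarrow> nat"
  assumes "computable F" "computable G"
  shows "decidable (\<lambda>x. F x < G x)"
  unfolding decidable_def
proof (rule computable_rec_nat'[where N = "\<lambda>x. G x - F x" and A = "\<lambda>x. 0" and H = "\<lambda>n v x. 1"])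
  show "computable (\<lambda>x. G x - F x)"
    using assms by (intro computable_diff)
  show "of_bool (F x < G x) = rec_nat 0 (\<lambda>n v. 1::nat) (G x - F x)" for x
    by (cases "G x - F x") auto
qed (rule computable_const)+

lemma decidable_le:
  fixes F G :: "'a::coded \<Rightarrow> nat"
  assumes "computable F" "computable G"
  shows "decidable (\<lambda>x. F x \<le> G x)"
  using decidable_not[OF decidable_less[OF assms(2,1)]] by (simp add: not_less)

lemma decidable_eq:
  assumes "computable F" "computable G"
  shows "decidable (\<lambda>x. F x = G x)"
proof -
  have "decidable (\<lambda>x. enc (F x) \<le> enc (G x) \<and> enc (G x) \<le> enc (F x))"
    using assms by (intro decidable_conj decidable_le computable_enc)
  moreover have "F x = G x \<longleftrightarrow> enc (F x) \<le> enc (G x) \<and> enc (G x) \<le> enc (F x)" for x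
    by (metis enc_eq_iff order_antisym order_refl)
  ultimately show ?thesis by simp
qed

lemma decidable_all_less:
  fixes N :: "'a::coded \<Rightarrow> nat"
  assumes "computable N" "decidable (\<lambda>t. P (fst t) (snd t))"
  shows "decidable (\<lambda>x. \<forall>y<N x. P y x)"
  unfolding decidable_def
proof (rule computable_rec_nat'[where N = N and A = "\<lambda>x. 1" and
      H = "\<lambda>y v x. if P y x then v else (0::nat)"])
  show "computable (\<lambda>t. if P (fst t) (snd (snd t)) then fst (snd t) else (0::nat))"
    using decidable_compose[OF assms(2), of "\<lambda>t. (fst t, snd (snd t))"]
    by (intro computable_if computable_fst computable_snd computable_id computable_const)
      (simp add: computable_Pair computable_fst computable_snd computable_id)
  show "of_bool (\<forall>y<N x. P y x) = rec_nat 1 (\<lambda>y v. if P y x then v else (0::nat)) (N x)" for x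
  proof -
    have "of_bool (\<forall>y<n. P y x) = rec_nat 1 (\<lambda>y v. if P y x then v else (0::nat)) n" for n
      by (induction n) (auto simp: less_Suc_eq split: if_splits)
    then show ?thesis .
  qed
qed (use assms in \<open>auto intro: computable_const\<close>)

lemma decidable_ex_less:
  fixes N :: "'a::coded \<Rightarrow> nat"
  assumes "computable N" "decidable (\<lambda>t. P (fst t) (snd t))"
  shows "decidable (\<lambda>x. \<exists>y<N x. P y x)"
  using decidable_not[OF decidable_all_less[OF assms(1) decidable_not[OF assms(2)]]] by simp

section \<open>Operations on lists\<close>

lemma computable_Cons:
  assumes "computable F" "computable G"
  shows "computable (\<lambda>x. F x # G x)"
proof -
  have "computable (\<lambda>x. Suc (enc (F x, G x)))"
    using assms by (intro computable_Suc computable_enc computable_Pair)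
  then show ?thesis unfolding computable_def by simp
qed

lemma prod_decode_0: "prod_decode 0 = (0, 0)"
  using prod_encode_inverse[of "(0, 0)"] by (simp add: prod_encode_def)

text \<open>The empty list has code 0, and both the truncated predecessor and
  \<open>prod_decode\<close> fix zero, so one formula also covers \<open>tl [] = []\<close>.\<close>

lemma enc_tl: "enc (tl xs) = snd (prod_decode (enc xs - 1))"
  by (cases xs) (auto simp: prod_decode_0)

lemma computable_tl:
  assumes "computable F"
  shows "computable (\<lambda>x. tl (F x))"
proof -
  have "computable (\<lambda>x. snd (prod_decode (enc (F x) - 1)))"
    using assms by (intro computable_compose[OF computable_snd_nat] computable_diff computable_enc
        computable_const)
  then show ?thesis unfolding computable_def by (simp add: enc_tl)
qed

lemma computable_drop:
  fixes N :: "'a::coded \<Rightarrow> nat" and F :: "'a \<Rightarrow> 'b::coded list"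
  assumes "computable N" "computable F"
  shows "computable (\<lambda>x. drop (N x) (F x))"
proof (rule computable_rec_nat'[where N = N and A = F and H = "\<lambda>n v x. tl v"])
  show "computable (\<lambda>t::nat \<times> 'b list \<times> 'a. tl (fst (snd t)))"
    by (intro computable_tl computable_fst computable_snd computable_id)
  show "drop (N x) (F x) = rec_nat (F x) (\<lambda>n v. tl v) (N x)" for x
  proof -
    have "drop n (F x) = rec_nat (F x) (\<lambda>n v. tl v) n" for n
      by (induction n) (auto simp: drop_Suc tl_drop[symmetric])
    then show ?thesis .
  qed
qed (use assms in auto)

text \<open>A total variant of \<open>nth\<close>; the default \<open>dec 0\<close> is what the coding yields on \<open>[]\<close>.\<close>

definition lookup :: "'a::coded list \<Rightarrow> nat \<Rightarrow> 'a" where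
  "lookup xs i = (if i < length xs then xs ! i else dec 0)"

lemma enc_lookup: "enc (lookup xs i) = fst (prod_decode (enc (drop i xs) - 1))"
proof (cases "i < length xs")
  case True
  then have "drop i xs = xs ! i # drop (Suc i) xs"
    by (simp add: Cons_nth_drop_Suc)
  with True show ?thesis by (simp add: lookup_def)
qed (simp add: lookup_def prod_decode_0)

lemma computable_lookup:
  assumes "computable F" "computable N"
  shows "computable (\<lambda>x. lookup (F x) (N x))"
proof -
  have "computable (\<lambda>x. fst (prod_decode (enc (drop (N x) (F x)) - 1)))"
    using assms by (intro computable_compose[OF computable_fst_nat] computable_diff computable_enc
        computable_const computable_drop)
  then show ?thesis unfolding computable_def by (simp add: enc_lookup)
qed

lemma length_le_enc: "length xs \<le> enc xs"
proof (induction xs)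
  case (Cons x xs)
  then show ?case using le_prod_encode_2[of "enc xs" "enc x"] by simp
qed simp

text \<open>The code of a list bounds its length, so that many recursion steps suffice to count its
  nonempty suffixes.\<close>

lemma computable_length:
  fixes F :: "'a::coded \<Rightarrow> 'b::coded list"
  assumes "computable F"
  shows "computable (\<lambda>x. length (F x))"
proof (rule computable_rec_nat'[where N = "\<lambda>x. enc (F x)" and A = "\<lambda>x. 0" and
      H = "\<lambda>n v x. if drop n (F x) = [] then v else Suc v"])
  show "computable (\<lambda>x. enc (F x))" using assms by (rule computable_enc)
  show "computable (\<lambda>t. if drop (fst t) (F (snd (snd t))) = [] then fst (snd t)
      else Suc (fst (snd t)))"
    by (intro computable_if decidable_eq computable_drop computable_compose[OF assms]
        computable_Suc computable_fst computable_snd computable_id computable_const)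
  show "length (F x) = rec_nat 0 (\<lambda>n v. if drop n (F x) = [] then v else Suc v) (enc (F x))" for x
  proof -
    have "rec_nat 0 (\<lambda>n v. if drop n (F x) = [] then v else Suc v) n = min n (length (F x))" for n
      by (induction n) auto
    then show ?thesis using length_le_enc[of "F x"] by (simp add: min_def)
  qed
qed (rule computable_const)

lemma decidable_list_ex:
  assumes "computable L" "decidable (\<lambda>t. P (fst t) (snd t))"
  shows "decidable (\<lambda>x. \<exists>a\<in>set (L x). P a x)"
proof -
  have "decidable (\<lambda>x. \<exists>i<length (L x). P (lookup (L x) i) x)"
    by (intro decidable_ex_less computable_length assms(1)
        decidable_compose[OF assms(2), of "\<lambda>t. (lookup (L (snd t)) (fst t), snd t)", simplified]
        computable_Pair computable_lookup computable_compose[OF assms(1)]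
        computable_fst computable_snd computable_id)
  moreover have "(\<exists>a\<in>set (L x). P a x) \<longleftrightarrow> (\<exists>i<length (L x). P (lookup (L x) i) x)" for x
    by (auto simp: lookup_def Bex_def in_set_conv_nth)
  ultimately show ?thesis by simp
qed

lemma decidable_mem: "computable F \<Longrightarrow> computable L \<Longrightarrow> decidable (\<lambda>x. F x \<in> set (L x))"
  using decidable_list_ex[of L "\<lambda>a x. a = F x"]
  by (simp add: Bex_def decidable_eq computable_fst computable_id computable_snd computable_compose)

lemma decidable_case_list:
  assumes "computable L" "decidable Q" "decidable (\<lambda>t. P (fst t) (fst (snd t)) (snd (snd t)))"
  shows "decidable (\<lambda>x. case L x of [] \<Rightarrow> Q x | a # as \<Rightarrow> P a as x)"
proof -
  have "decidable (\<lambda>x. if L x = [] then Q x else P (lookup (L x) 0) (tl (L x)) x)"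
    using decidable_compose[OF assms(3), of "\<lambda>x. (lookup (L x) 0, tl (L x), x)"]
    by (intro decidable_if decidable_eq computable_const assms(1,2))
      (simp add: computable_Pair computable_lookup computable_tl computable_id computable_const assms(1))
  also have "(\<lambda>x. if L x = [] then Q x else P (lookup (L x) 0) (tl (L x)) x) =
      (\<lambda>x. case L x of [] \<Rightarrow> Q x | a # as \<Rightarrow> P a as x)"
    by (auto simp: lookup_def fun_eq_iff split: list.split)
  finally show ?thesis .
qed

lemma decidable_case_nat:
  assumes "computable N" "decidable Q" "decidable (\<lambda>t. P (fst t) (snd t))"
  shows "decidable (\<lambda>x. case N x of 0 \<Rightarrow> Q x | Suc n \<Rightarrow> P n x)"
proof -
  have "decidable (\<lambda>x. if N x = 0 then Q x else P (N x - 1) x)"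
    using decidable_compose[OF assms(3), of "\<lambda>x. (N x - 1, x)"]
    by (intro decidable_if decidable_eq computable_const assms(1,2))
      (simp add: computable_Pair computable_id computable_const computable_diff assms(1))
  also have "(\<lambda>x. if N x = 0 then Q x else P (N x - 1) x) =
      (\<lambda>x. case N x of 0 \<Rightarrow> Q x | Suc n \<Rightarrow> P n x)"
    by (auto simp: fun_eq_iff split: nat.split)
  finally show ?thesis .
qed

lemma computable_power:
  fixes F G :: "'a::coded \<Rightarrow> nat"
  assumes "computable F" "computable G"
  shows "computable (\<lambda>x. F x ^ G x)"
proof (rule computable_rec_nat'[OF assms(2) computable_const[of 1], where H = "\<lambda>n v x. F x * v"])
  show "computable (\<lambda>t::nat \<times> nat \<times> 'a. F (snd (snd t)) * fst (snd t))"
    by (intro computable_mult computable_compose[OF assms(1)] computable_fst computable_snd computable_id)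
  show "F x ^ G x = rec_nat 1 (\<lambda>n v. F x * v) (G x)" for x
  proof -
    have "F x ^ n = rec_nat 1 (\<lambda>n v. F x * v) n" for n by (induction n) auto
    then show ?thesis .
  qed
qed

lemmas computable_intros =
  computable_const computable_id computable_Pair computable_fst computable_snd computable_Suc
  computable_enc computable_dec computable_add computable_diff computable_mult computable_power
  computable_if computable_Cons computable_tl computable_drop computable_lookup computable_length
  computable_of_bool
  decidable_const decidable_if decidable_not decidable_conj decidable_disj decidable_imp
  decidable_less decidable_le decidable_eq decidable_all_less decidable_ex_less
  decidable_list_ex decidable_mem decidable_case_list decidable_case_nat

section \<open>Certified computations\<close>

fun code :: "recf \<Rightarrow> nat" where
  "code Zero = prod_encode (0, 0)"
| "code Succ = prod_encode (1, 0)"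
| "code (Proj i) = prod_encode (2, i)"
| "code Query = prod_encode (3, 0)"
| "code (Comp f gs) = prod_encode (4, prod_encode (code f, list_encode (map code gs)))"
| "code (PrimRec f g) = prod_encode (5, prod_encode (code f, code g))"
| "code (Mu f) = prod_encode (6, code f)"

text \<open>
  A claim \<open>(c, xs, v)\<close> says that the program with code \<open>c\<close> returns \<open>v\<close> on \<open>xs\<close>. In a valid list
  every claim follows from later ones by a single evaluation rule, so that the list is a decidable
  certificate for all its claims.
\<close>

type_synonym claim = "nat \<times> nat list \<times> nat"

text \<open>Here \<open>op\<close> and \<open>arg\<close> are the two components of the code
  \<open>c\<close>; \<open>c\<close> itself is kept because a primitive recursion appeals to an
  earlier claim about the same program. \<open>Query\<close> answers 0 since only unrelativized runs
  are certified. All quantifiers range over list entries or below a number, which keeps the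
  condition decidable. Reading every other \<open>op\<close> as \<open>Mu\<close> is harmless:
  soundness only concerns codes of programs.\<close>

definition justified :: "claim list \<Rightarrow> nat \<Rightarrow> nat \<Rightarrow> nat \<Rightarrow> nat list \<Rightarrow> nat \<Rightarrow> bool" where
  "justified ts c op arg xs v \<longleftrightarrow>
    (if op = 0 then v = 0
     else if op = 1 then (case xs of [] \<Rightarrow> False | x # ys \<Rightarrow> v = Suc x)
     else if op = 2 then arg < length xs \<and> v = lookup xs arg
     else if op = 3 then (case xs of [] \<Rightarrow> False | x # ys \<Rightarrow> v = 0)
     else if op = 4 then
       (\<exists>t\<in>set ts. fst t = fst (prod_decode arg) \<and> snd (snd t) = v \<and>
          length (fst (snd t)) = length (dec (snd (prod_decode arg)) :: nat list) \<and>
          (\<forall>j<length (fst (snd t)).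
             (lookup (dec (snd (prod_decode arg))) j, xs, lookup (fst (snd t)) j) \<in> set ts))
     else if op = 5 then
       (case xs of [] \<Rightarrow> False
        | x # ys \<Rightarrow>
            (case x of 0 \<Rightarrow> (fst (prod_decode arg), ys, v) \<in> set ts
             | Suc n \<Rightarrow> (\<exists>t\<in>set ts. fst t = c \<and> fst (snd t) = n # ys \<and>
                 (snd (prod_decode arg), n # snd (snd t) # ys, v) \<in> set ts)))
     else
       (arg, v # xs, 0) \<in> set ts \<and>
       (\<forall>z<v. \<exists>t\<in>set ts. fst t = arg \<and> fst (snd t) = z # xs \<and> 0 < snd (snd t)))"

definition justified_claim :: "claim list \<Rightarrow> claim \<Rightarrow> bool" where
  "justified_claim ts t \<longleftrightarrow>
    justified ts (fst t) (fst (prod_decode (fst t))) (snd (prod_decode (fst t)))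
      (fst (snd t)) (snd (snd t))"

fun valid :: "claim list \<Rightarrow> bool" where
  "valid [] \<longleftrightarrow> True"
| "valid (t # ts) \<longleftrightarrow> justified_claim ts t \<and> valid ts"

lemma justified_mono: "justified ts c op arg xs v \<Longrightarrow> set ts \<subseteq> set us \<Longrightarrow> justified us c op arg xs v"
  unfolding justified_def
  by (auto split: if_splits list.splits nat.splits) (meson subsetD)+

lemma valid_append: "valid ts \<Longrightarrow> valid us \<Longrightarrow> valid (ts @ us)"
  by (induction ts) (auto simp: justified_claim_def elim: justified_mono)

lemma valid_union:
  assumes "finite I" "\<And>i. i \<in> I \<Longrightarrow> \<exists>ts. valid ts \<and> T i \<in> set ts"
  shows "\<exists>ts. valid ts \<and> T ` I \<subseteq> set ts"
  using assms
proof (induction I rule: finite_induct)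
  case empty
  show ?case by (rule exI[of _ "[]"]) simp
next
  case (insert i I)
  then obtain ts us where "valid ts" "T ` I \<subseteq> set ts" "valid us" "T i \<in> set us"
    by blast
  then show ?case by (intro exI[of _ "us @ ts"]) (auto simp: valid_append)
qed

lemma run_Comp_iff:
  "run (Comp f gs) xs = Some v \<longleftrightarrow>
    (\<exists>vs. length vs = length gs \<and> (\<forall>j<length gs. run (gs ! j) xs = Some (vs ! j)) \<and> run f vs = Some v)"
  (is "?L \<longleftrightarrow> ?R")
proof
  assume L: ?L
  then have all: "\<forall>g\<in>set gs. run g xs \<noteq> None"
    by (auto split: if_splits)
  with L have "run f (map (\<lambda>g. the (run g xs)) gs) = Some v"
    by simp
  with all show ?R by (intro exI[of _ "map (\<lambda>g. the (run g xs)) gs"]) auto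
next
  assume ?R
  then obtain vs where vs: "length vs = length gs" "\<forall>j<length gs. run (gs ! j) xs = Some (vs ! j)"
    "run f vs = Some v" by blast
  then have "map (\<lambda>g. the (run g xs)) gs = vs"
    by (intro nth_equalityI) auto
  moreover have "\<forall>g\<in>set gs. run g xs \<noteq> None"
    using vs(2) by (auto simp: in_set_conv_nth)
  ultimately show ?L using vs(3) by simp
qed

lemma run_PrimRec_0: "run (PrimRec f g) (0 # ys) = run f ys"
  by simp

lemma run_PrimRec_Suc:
  "run (PrimRec f g) (Suc n # ys) = Option.bind (run (PrimRec f g) (n # ys)) (\<lambda>u. run g (n # u # ys))"
  by simp

text \<open>Trades \<open>LEAST\<close> for conditions on finitely many runs, which is what a
  certificate can record.\<close>

lemma run_Mu_iff:
  "run (Mu f) xs = Some v \<longleftrightarrow>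
    run f (v # xs) = Some 0 \<and> (\<forall>z<v. \<exists>w>0. run f (z # xs) = Some w)" (is "?L \<longleftrightarrow> ?R")
proof
  assume ?L
  then obtain y where y: "run f (y # xs) = Some 0" "\<forall>z<y. run f (z # xs) \<noteq> None"
    and v: "v = (LEAST y. run f (y # xs) = Some 0)"
    by (auto split: if_splits)
  have "v \<le> y" unfolding v using y(1) by (rule Least_le)
  moreover have "run f (v # xs) = Some 0" unfolding v using y(1) by (rule LeastI)
  moreover have "run f (z # xs) \<noteq> Some 0" if "z < v" for z
    using that unfolding v by (rule not_less_Least)
  ultimately show ?R using y(2) by (metis gr0I not_None_eq order_less_le_trans)
next
  assume R: ?R
  have "(LEAST y. run f (y # xs) = Some 0) = v"
  proof (rule Least_equality)
    show "v \<le> y" if "run f (y # xs) = Some 0" for y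
      using R that by (metis not_less option.inject less_irrefl)
  qed (use R in simp)
  moreover have "\<exists>y. run f (y # xs) = Some 0 \<and> (\<forall>z<y. run f (z # xs) \<noteq> None)"
    using R by (intro exI[of _ v]) auto
  ultimately show ?L by simp
qed

lemma dec_list_encode [simp]: "dec (list_encode ns) = ns"
proof -
  have "map enc ns = ns" by (simp add: map_idI)
  then show ?thesis by (metis dec_enc enc_list_def)
qed

text \<open>Induction on the list: the head claim rests only on claims in the tail, which are true
  by the induction hypothesis, so support cannot be circular.\<close>

lemma valid_sound: "valid ts \<Longrightarrow> (code p, xs, v) \<in> set ts \<Longrightarrow> run p xs = Some v"
proof (induction ts arbitrary: p xs v)
  case (Cons t ts)
  show ?case
  proof (cases "(code p, xs, v) \<in> set ts")
    case False
    with Cons.prems have "justified ts (code p) (fst (prod_decode (code p)))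
        (snd (prod_decode (code p))) xs v"
      by (auto simp: justified_claim_def)
    moreover have IH: "run q ys = Some w" if "(code q, ys, w) \<in> set ts" for q ys w
      using Cons.IH Cons.prems(1) that by simp
    ultimately show ?thesis
    proof (cases p)
      case (Comp f gs)
      then obtain t where t: "t \<in> set ts" "fst t = code f" "snd (snd t) = v"
        "length (fst (snd t)) = length gs"
        "\<forall>j<length gs. (lookup (map code gs) j, xs, lookup (fst (snd t)) j) \<in> set ts"
        using \<open>justified _ _ _ _ _ _\<close> by (auto simp: justified_def)
      have "run (gs ! j) xs = Some (fst (snd t) ! j)" if "j < length gs" for j
        using t(4) t(5)[rule_format, OF that] that by (intro IH) (simp add: lookup_def)
      moreover have "run f (fst (snd t)) = Some v"
        using t(1-3) by (intro IH) (metis prod.collapse)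
      ultimately show ?thesis unfolding Comp run_Comp_iff using t(4) by blast
    next
      case (PrimRec f g)
      have j: "justified ts (code p) 5 (prod_encode (code f, code g)) xs v"
        using \<open>justified _ _ _ _ _ _\<close> PrimRec by simp
      show ?thesis
      proof (cases xs)
        case Nil
        with j show ?thesis by (simp add: justified_def)
      next
        case xs: (Cons x ys)
        show ?thesis
        proof (cases x)
          case 0
          with j xs have "(code f, ys, v) \<in> set ts" by (simp add: justified_def)
          then show ?thesis unfolding PrimRec xs 0 run_PrimRec_0 by (rule IH)
        next
          case (Suc n)
          with j xs obtain t where t: "t \<in> set ts" "fst t = code p" "fst (snd t) = n # ys"
            "(code g, n # snd (snd t) # ys, v) \<in> set ts"
            by (auto simp: justified_def)
          have "run p (n # ys) = Some (snd (snd t))"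
            using t(1-3) by (intro IH) (metis prod.collapse)
          moreover have "run g (n # snd (snd t) # ys) = Some v"
            using t(4) by (rule IH)
          ultimately show ?thesis unfolding PrimRec xs Suc run_PrimRec_Suc by simp
        qed
      qed
    next
      case (Mu f)
      then have j: "justified ts (code p) 6 (code f) xs v"
        using \<open>justified _ _ _ _ _ _\<close> by simp
      then have "run f (v # xs) = Some 0"
        by (intro IH) (simp add: justified_def)
      moreover have "\<exists>w>0. run f (z # xs) = Some w" if "z < v" for z
      proof -
        from j that obtain t where t: "t \<in> set ts" "fst t = code f" "fst (snd t) = z # xs"
          "0 < snd (snd t)" by (auto simp: justified_def)
        then have "run f (z # xs) = Some (snd (snd t))"
          by (intro IH) (metis prod.collapse)
        with t(4) show ?thesis by blast
      qed
      ultimately show ?thesis unfolding Mu run_Mu_iff by blast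
    qed (auto simp: justified_def lookup_def split: list.splits)
  qed (use Cons in auto)
qed simp

lemma valid_step: "valid ts \<Longrightarrow> justified_claim ts t \<Longrightarrow> \<exists>us. valid us \<and> t \<in> set us"
  by (intro exI[of _ "t # ts"]) simp

text \<open>Induction on the program, with an inner induction on the recursion argument for
  \<open>PrimRec\<close>. Certificates of the subcomputations are concatenated and the new claim is
  put in front.\<close>

lemma valid_complete: "run p xs = Some v \<Longrightarrow> \<exists>ts. valid ts \<and> (code p, xs, v) \<in> set ts"
proof (induction p arbitrary: xs v)
  case (Comp f gs)
  then obtain vs where vs: "length vs = length gs" "\<forall>j<length gs. run (gs ! j) xs = Some (vs ! j)"
    "run f vs = Some v" unfolding run_Comp_iff by blast
  obtain ts where ts: "valid ts" "(code f, vs, v) \<in> set ts"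
    using Comp.IH(1)[OF vs(3)] by blast
  have "\<exists>us. valid us \<and> (\<lambda>j. (code (gs ! j), xs, vs ! j)) ` {..<length gs} \<subseteq> set us"
    by (rule valid_union) (use vs(2) Comp.IH(2) in auto)
  then obtain us where us: "valid us" "(\<lambda>j. (code (gs ! j), xs, vs ! j)) ` {..<length gs} \<subseteq> set us"
    by blast
  have "justified_claim (ts @ us) (code (Comp f gs), xs, v)"
    using ts(2) us(2) vs(1)
    by (auto simp: justified_claim_def justified_def lookup_def intro!: bexI[of _ "(code f, vs, v)"])
  with valid_append[OF ts(1) us(1)] show ?case by (rule valid_step)
next
  case (PrimRec f g)
  from PrimRec.prems obtain n ys where xs: "xs = n # ys" by (cases xs) auto
  have "\<exists>ts. valid ts \<and> (code (PrimRec f g), n # ys, v) \<in> set ts"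
    if "run (PrimRec f g) (n # ys) = Some v" for n v
    using that
  proof (induction n arbitrary: v)
    case 0
    then have "run f ys = Some v" by simp
    then obtain ts where "valid ts" "(code f, ys, v) \<in> set ts" using PrimRec.IH(1) by blast
    then show ?case by (intro valid_step[of ts]) (auto simp: justified_claim_def justified_def)
  next
    case (Suc n)
    then obtain u where u: "run (PrimRec f g) (n # ys) = Some u" "run g (n # u # ys) = Some v"
      unfolding run_PrimRec_Suc by (auto simp: bind_eq_Some_conv)
    obtain ts where ts: "valid ts" "(code (PrimRec f g), n # ys, u) \<in> set ts"
      using Suc.IH[OF u(1)] by blast
    obtain us where us: "valid us" "(code g, n # u # ys, v) \<in> set us"
      using PrimRec.IH(2)[OF u(2)] by blast
    have "justified_claim (ts @ us) (code (PrimRec f g), Suc n # ys, v)"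
      using ts(2) us(2)
      by (auto simp: justified_claim_def justified_def
          intro!: bexI[of _ "(code (PrimRec f g), n # ys, u)"])
    with valid_append[OF ts(1) us(1)] show ?case by (rule valid_step)
  qed
  with PrimRec.prems xs show ?case by blast
next
  case (Mu f)
  then have v: "run f (v # xs) = Some 0" and z: "\<forall>z<v. \<exists>w>0. run f (z # xs) = Some w"
    unfolding run_Mu_iff by blast+
  from z obtain w where w: "\<And>z. z < v \<Longrightarrow> 0 < w z \<and> run f (z # xs) = Some (w z)" by metis
  obtain ts where ts: "valid ts" "(code f, v # xs, 0) \<in> set ts"
    using Mu.IH[OF v] by blast
  have "\<exists>us. valid us \<and> (\<lambda>z. (code f, z # xs, w z)) ` {..<v} \<subseteq> set us"
    by (rule valid_union) (use w Mu.IH in auto)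
  then obtain us where us: "valid us" "(\<lambda>z. (code f, z # xs, w z)) ` {..<v} \<subseteq> set us"
    by blast
  have "\<exists>t\<in>set (ts @ us). fst t = code f \<and> fst (snd t) = z # xs \<and> 0 < snd (snd t)" if "z < v" for z
    using us(2) w that by (intro bexI[of _ "(code f, z # xs, w z)"]) auto
  then have "justified_claim (ts @ us) (code (Mu f), xs, v)"
    using ts(2) unfolding justified_claim_def justified_def by simp
  with valid_append[OF ts(1) us(1)] show ?case by (rule valid_step)
qed (auto intro!: exI[of _ "[_]"] simp: justified_claim_def justified_def lookup_def
      split: list.splits if_splits)

text \<open>Turns the recursive definition into a bounded quantifier over positions, to which the
  closure properties of decidable predicates apply.\<close>

lemma valid_iff: "valid ts \<longleftrightarrow> (\<forall>j<length ts. justified_claim (drop (Suc j) ts) (lookup ts j))"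
proof (induction ts)
  case (Cons t ts)
  have "lookup (t # ts) (Suc j) = lookup ts j" "lookup (t # ts) 0 = t" for j
    by (auto simp: lookup_def)
  with Cons.IH show ?case by (simp add: All_less_Suc2)
qed simp

lemma decidable_justified:
  assumes "computable L" "computable C" "computable D" "computable B" "computable X" "computable V"
  shows "decidable (\<lambda>t. justified (L t) (C t) (D t) (B t) (X t) (V t))"
  unfolding justified_def
  by (intro computable_intros computable_compose[OF computable_fst_nat]
    computable_compose[OF computable_snd_nat]
    computable_compose[OF assms(1)] computable_compose[OF assms(2)] computable_compose[OF assms(3)]
    computable_compose[OF assms(4)] computable_compose[OF assms(5)] computable_compose[OF assms(6)])

lemma decidable_justified_claim:
  assumes "computable L" "computable T"
  shows "decidable (\<lambda>t. justified_claim (L t) (T t))"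
  unfolding justified_claim_def
  by (intro decidable_justified computable_fst computable_snd assms
    computable_compose[OF computable_fst_nat] computable_compose[OF computable_snd_nat])

lemma decidable_valid: 
  assumes "computable L"
  shows "decidable (\<lambda>t. valid (L t))"
  unfolding valid_iff
  by (intro computable_intros decidable_justified_claim computable_compose[OF assms] assms)

section \<open>A sequence visiting the complement of a universal set\<close>

text \<open>Each quantifier of the hierarchy prepends its variable, so the innermost variable
  \<open>z\<close> stands first in the tuple.\<close>

lemma Sigma_set_2_iff:
  "Sigma_set 2 S \<longleftrightarrow> (\<exists>R. decidable_rel 3 R \<and> (\<forall>i. i \<in> S \<longleftrightarrow> (\<exists>y. \<forall>z. [z, y, i] \<in> R)))"
proof -
  have "Sigma_set 2 S \<longleftrightarrow> (\<exists>Q. (\<exists>R. decidable_rel 3 R \<and>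
      (\<forall>xs. length xs = 2 \<longrightarrow> (xs \<in> Q \<longleftrightarrow> (\<forall>z. z # xs \<in> R)))) \<and>
      (\<forall>i. i \<in> S \<longleftrightarrow> (\<exists>y. [y, i] \<in> Q)))"
    by (simp add: Sigma_set_def numeral_2_eq_2 numeral_3_eq_3 length_Suc_conv,
        intro iff_exI arg_cong2[of _ _ _ _ conj] refl) auto
  also have "\<dots> \<longleftrightarrow> (\<exists>R. decidable_rel 3 R \<and> (\<forall>i. i \<in> S \<longleftrightarrow> (\<exists>y. \<forall>z. [z, y, i] \<in> R)))"
    (is "?L \<longleftrightarrow> ?R")
  proof
    assume ?R
    then obtain R where R: "decidable_rel 3 R" "\<forall>i. i \<in> S \<longleftrightarrow> (\<exists>y. \<forall>z. [z, y, i] \<in> R)"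
      by blast
    then show ?L
      by (intro exI[of _ "{xs. \<forall>z. z # xs \<in> R}"] conjI exI[of _ R]) auto
  qed fastforce
  finally show ?thesis .
qed

lemma decidable_rel_3I:
  assumes "decidable (\<lambda>t::nat \<times> nat \<times> nat. P (fst t) (fst (snd t)) (snd (snd t)))"
  shows "decidable_rel 3 {[z, y, i] | z y i. P z y i}"
proof -
  from assms obtain p where
    p: "\<And>e t. eval e p [enc t] = Some (of_bool (P (fst t) (fst (snd t)) (snd (snd t))))"
    unfolding decidable_def computable_def enc_nat_eq by blast
  have p': "eval e p [prod_encode (z, prod_encode (y, i))] = Some (of_bool (P z y i))" for e z y i
    using p[of e "(z, y, i)"] by simp
  define q where "q = Comp p [Comp pair_prog [Proj 0, Comp pair_prog [Proj 1, Proj 2]]]"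
  have "run q xs = Some (if xs \<in> {[z, y, i] | z y i. P z y i} then 1 else 0)"
    if xs: "length xs = 3" for xs
  proof -
    obtain z y i where "xs = [z, y, i]"
      using xs by (auto simp: numeral_3_eq_3 length_Suc_conv)
    then show ?thesis by (simp add: q_def p')
  qed
  then show ?thesis unfolding decidable_rel_def by blast
qed

text \<open>
  For \<open>k = prod_encode (c, i)\<close>, the number \<open>w\<close> refutes \<open>y\<close> if it codes a number \<open>z\<close> and a
  valid computation showing that program \<open>c\<close> rejects \<open>[z, y, i]\<close>.
\<close>

definition refutes :: "nat \<Rightarrow> nat \<Rightarrow> nat \<Rightarrow> bool" where
  "refutes k y w \<longleftrightarrow>
    valid (snd (dec w :: nat \<times> claim list)) \<and>
    (fst (prod_decode k), [fst (dec w :: nat \<times> claim list), y, snd (prod_decode k)], 0)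
      \<in> set (snd (dec w :: nat \<times> claim list))"

lemma decidable_refutes:
  assumes "computable K" "computable Y" "computable W"
  shows "decidable (\<lambda>t. refutes (K t) (Y t) (W t))"
  unfolding refutes_def
  by (intro computable_intros decidable_valid assms
    computable_compose[OF computable_fst_nat] computable_compose[OF computable_snd_nat])

lemma refutes_code:
  "(\<exists>w. refutes (prod_encode (code p, i)) y w) \<longleftrightarrow> (\<exists>z. run p [z, y, i] = Some 0)"
proof
  assume "\<exists>w. refutes (prod_encode (code p, i)) y w"
  then show "\<exists>z. run p [z, y, i] = Some 0"
    unfolding refutes_def by (auto intro: valid_sound)
next
  assume "\<exists>z. run p [z, y, i] = Some 0"
  then obtain z ts where "valid ts" "(code p, [z, y, i], 0) \<in> set ts"
    using valid_complete by blast
  then show "\<exists>w. refutes (prod_encode (code p, i)) y w"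
    unfolding refutes_def by (intro exI[of _ "enc (z, ts)"]) (simp del: enc_Pair)
qed

text \<open>This is universality: \<open>c\<close> is the code of a program deciding the matrix of
  the given set and does not depend on \<open>i\<close>. That program is total on triples, so
  failure of the matrix always shows up as a halting run with value 0, which has a
  certificate.\<close>

lemma Sigma_set_2_refutes:
  assumes "Sigma_set 2 S"
  shows "\<exists>c. \<forall>i. i \<in> S \<longleftrightarrow> \<not> (\<forall>y. \<exists>w. refutes (prod_encode (c, i)) y w)"
proof -
  from assms obtain R p where R: "\<And>i. i \<in> S \<longleftrightarrow> (\<exists>y. \<forall>z. [z, y, i] \<in> R)"
    and p: "\<And>xs. length xs = 3 \<Longrightarrow> run p xs = Some (if xs \<in> R then 1 else 0)"
    unfolding Sigma_set_2_iff decidable_rel_def by blast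
  have "run p [z, y, i] = Some 0 \<longleftrightarrow> [z, y, i] \<notin> R" for z y i
    using p[of "[z, y, i]"] by simp
  then have "i \<in> S \<longleftrightarrow> \<not> (\<forall>y. \<exists>w. refutes (prod_encode (code p, i)) y w)" for i
    unfolding refutes_code R by blast
  then show ?thesis by blast
qed

definition refuted_below :: "nat \<Rightarrow> nat \<Rightarrow> nat \<Rightarrow> bool" where
  "refuted_below k l m \<longleftrightarrow> (\<forall>y<l. \<exists>w<m. refutes k y w)"

text \<open>For each \<open>l\<close> at most one \<open>n = prod_encode (l, m)\<close> makes progress, namely for the least \<open>m\<close>.\<close>

definition progress :: "nat \<Rightarrow> nat \<Rightarrow> bool" where
  "progress k n \<longleftrightarrow> refuted_below k (fst (prod_decode n)) (snd (prod_decode n)) \<and>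
    (\<forall>m<snd (prod_decode n). \<not> refuted_below k (fst (prod_decode n)) m)"

lemma progress_iff: "progress k (prod_encode (l, m)) \<longleftrightarrow>
    refuted_below k l m \<and> (\<forall>m'<m. \<not> refuted_below k l m')"
  by (simp add: progress_def)

lemma progress_unique:
  "progress k (prod_encode (l, m)) \<Longrightarrow> progress k (prod_encode (l, m')) \<Longrightarrow> m = m'"
  unfolding progress_iff by (metis linorder_neqE_nat)

text \<open>If every \<open>y\<close> is refuted, each level \<open>l\<close> makes progress once,
  at its least sufficient bound. If some \<open>y\<close> is never refuted, only levels up to
  \<open>y\<close> can make progress, and each of them does so at most once.\<close>

lemma infinite_progress_iff: "infinite {n. progress k n} \<longleftrightarrow> (\<forall>y. \<exists>w. refutes k y w)"
proof
  assume all: "\<forall>y. \<exists>w. refutes k y w"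
  have "\<exists>m. refuted_below k l m" for l
  proof (induction l)
    case (Suc l)
    then obtain m w where "refuted_below k l m" "refutes k l w" using all by blast
    then have "refuted_below k (Suc l) (m + Suc w)"
      unfolding refuted_below_def by (metis add.commute less_Suc_eq trans_less_add1 less_add_Suc1 add_Suc_right)
    then show ?case ..
  qed (simp add: refuted_below_def)
  then have "\<exists>m. progress k (prod_encode (l, m))" for l
    unfolding progress_iff by (metis (full_types) exists_least_iff)
  then obtain m where m: "\<And>l. progress k (prod_encode (l, m l))" by metis
  have "inj (\<lambda>l. prod_encode (l, m l))" by (auto simp: inj_def)
  moreover have "range (\<lambda>l. prod_encode (l, m l)) \<subseteq> {n. progress k n}" using m by auto
  ultimately show "infinite {n. progress k n}"
    using range_inj_infinite infinite_super by blast
next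
  assume inf: "infinite {n. progress k n}"
  show "\<forall>y. \<exists>w. refutes k y w"
  proof (rule ccontr)
    assume "\<not> (\<forall>y. \<exists>w. refutes k y w)"
    then obtain y where y: "\<And>w. \<not> refutes k y w" by blast
    have "inj_on (\<lambda>n. fst (prod_decode n)) {n. progress k n}"
    proof (rule inj_onI)
      fix a b assume "a \<in> {n. progress k n}" "b \<in> {n. progress k n}"
        "fst (prod_decode a) = fst (prod_decode b)"
      then show "a = b"
        using progress_unique by (metis mem_Collect_eq prod.collapse prod_decode_inverse)
    qed
    moreover have "(\<lambda>n. fst (prod_decode n)) ` {n. progress k n} \<subseteq> {..y}"
      using y unfolding progress_def refuted_below_def by (auto simp: not_le[symmetric])
    ultimately show False using inf finite_imageD finite_subset finite_atMost by metis
  qed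
qed

text \<open>The sequence has to be total, so 0 marks an idle step and the index \<open>k\<close> is
  represented by \<open>Suc k\<close>.\<close>

definition visit :: "nat \<Rightarrow> nat" where
  "visit n = (if progress (fst (prod_decode n)) (snd (prod_decode n))
    then Suc (fst (prod_decode n)) else 0)"

lemma computable_visit: "computable visit"
proof -
  have "computable (\<lambda>n. if progress (fst (prod_decode n)) (snd (prod_decode n))
    then Suc (fst (prod_decode n)) else 0)"
    unfolding progress_def refuted_below_def
    by (intro computable_intros decidable_refutes
      computable_compose[OF computable_fst_nat] computable_compose[OF computable_snd_nat])
  then show ?thesis unfolding visit_def[abs_def] .
qed

lemma infinite_visit_iff: "infinite {n. visit n = Suc k} \<longleftrightarrow> (\<forall>y. \<exists>w. refutes k y w)"
proof -
  have "{n. visit n = Suc k} = (\<lambda>m. prod_encode (k, m)) ` {m. progress k m}"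
    by (auto simp: visit_def image_iff split: if_splits) (metis prod.collapse prod_decode_inverse)
  moreover have "inj_on (\<lambda>m. prod_encode (k, m)) {m. progress k m}"
    by (auto simp: inj_on_def)
  ultimately show ?thesis
    by (simp add: infinite_progress_iff[symmetric] finite_image_iff)
qed

lemma Sigma_set_2_visit:
  assumes "Sigma_set 2 S"
  obtains c where "\<And>i. i \<in> S \<longleftrightarrow> finite {n. visit n = Suc (prod_encode (c, i))}"
  using Sigma_set_2_refutes[OF assms] infinite_visit_iff by blast

section \<open>Rational computations and ideal balls\<close>

text \<open>The second component is the predecessor of the denominator, so every pair of naturals is
  a fraction. Signs are avoided throughout: subtraction only occurs inside absolute values.\<close>

definition qval :: "nat \<times> nat \<Rightarrow> real" where
  "qval r = real (fst r) / real (Suc (snd r))"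

definition qcomputable :: "('a::coded \<Rightarrow> real) \<Rightarrow> bool" where
  "qcomputable F \<longleftrightarrow> (\<exists>G. computable G \<and> (\<forall>x. F x = qval (G x)))"

lemma qcomputableI: "computable G \<Longrightarrow> (\<And>x. F x = qval (G x)) \<Longrightarrow> qcomputable F"
  by (auto simp: qcomputable_def)

lemma qcomputable_qval: "computable F \<Longrightarrow> qcomputable (\<lambda>x. qval (F x))"
  by (rule qcomputableI) auto

lemma qcomputable_of_nat: "computable F \<Longrightarrow> qcomputable (\<lambda>x. real (F x))"
  by (rule qcomputableI[of "\<lambda>x. (F x, 0)"]) (auto intro: computable_intros simp: qval_def)

lemma qcomputable_0: "qcomputable (\<lambda>x. 0)"
  and qcomputable_1: "qcomputable (\<lambda>x. 1)"
  and qcomputable_numeral: "qcomputable (\<lambda>x. numeral n)"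
  using qcomputable_of_nat[of "\<lambda>_. 0"] qcomputable_of_nat[of "\<lambda>_. 1"]
    qcomputable_of_nat[of "\<lambda>_. numeral n"]
  by (simp_all add: computable_const)

lemma qcomputable_compose: "qcomputable F \<Longrightarrow> computable G \<Longrightarrow> qcomputable (\<lambda>x. F (G x))"
  unfolding qcomputable_def using computable_compose by blast

lemma Suc_denominator: "Suc (b + d + b * d) = Suc b * Suc d"
  by simp

lemma qcomputable_add:
  assumes "qcomputable F" "qcomputable G"
  shows "qcomputable (\<lambda>x. F x + G x)"
proof -
  obtain f g where fg: "computable f" "computable g"
    "\<And>x. F x = qval (f x)" "\<And>x. G x = qval (g x)"
    using assms unfolding qcomputable_def by blast
  show ?thesis
  proof (rule qcomputableI)
    show "computable (\<lambda>x. (fst (f x) * Suc (snd (g x)) + fst (g x) * Suc (snd (f x)),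
      snd (f x) + snd (g x) + snd (f x) * snd (g x)))"
      by (intro computable_intros fg)
    show "F x + G x = qval (fst (f x) * Suc (snd (g x)) + fst (g x) * Suc (snd (f x)),
      snd (f x) + snd (g x) + snd (f x) * snd (g x))" for x
      unfolding fg qval_def fst_conv snd_conv Suc_denominator of_nat_mult of_nat_add
      by (simp add: divide_simps del: of_nat_Suc)
  qed
qed

lemma qcomputable_mult:
  assumes "qcomputable F" "qcomputable G"
  shows "qcomputable (\<lambda>x. F x * G x)"
proof -
  obtain f g where fg: "computable f" "computable g"
    "\<And>x. F x = qval (f x)" "\<And>x. G x = qval (g x)"
    using assms unfolding qcomputable_def by blast
  show ?thesis
  proof (rule qcomputableI)
    show "computable (\<lambda>x. (fst (f x) * fst (g x), snd (f x) + snd (g x) + snd (f x) * snd (g x)))"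
      by (intro computable_intros fg)
    show "F x * G x = qval (fst (f x) * fst (g x), snd (f x) + snd (g x) + snd (f x) * snd (g x))" for x
      unfolding fg qval_def fst_conv snd_conv Suc_denominator of_nat_mult by simp
  qed
qed

lemma qval_less_iff: "qval r < qval s \<longleftrightarrow> fst r * Suc (snd s) < fst s * Suc (snd r)"
proof -
  have "qval r < qval s \<longleftrightarrow> real (fst r * Suc (snd s)) < real (fst s * Suc (snd r))"
    unfolding qval_def of_nat_mult by (simp add: divide_simps del: of_nat_Suc)
  then show ?thesis by (simp only: of_nat_less_iff)
qed

lemma decidable_qless:
  assumes "qcomputable F" "qcomputable G"
  shows "decidable (\<lambda>x. F x < G x)"
proof -
  obtain f g where fg: "computable f" "computable g"
    "\<And>x. F x = qval (f x)" "\<And>x. G x = qval (g x)"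
    using assms unfolding qcomputable_def by blast
  have "decidable (\<lambda>x. fst (f x) * Suc (snd (g x)) < fst (g x) * Suc (snd (f x)))"
    by (intro computable_intros fg)
  then show ?thesis by (simp only: fg(3,4) qval_less_iff)
qed

lemma qcomputable_if:
  assumes "decidable P" "qcomputable F" "qcomputable G"
  shows "qcomputable (\<lambda>x. if P x then F x else G x)"
proof -
  obtain f g where fg: "computable f" "computable g"
    "\<And>x. F x = qval (f x)" "\<And>x. G x = qval (g x)"
    using assms unfolding qcomputable_def by blast
  show ?thesis
    by (rule qcomputableI[of "\<lambda>x. if P x then f x else g x"])
      (auto intro: computable_if assms(1) fg simp: fg(3,4))
qed

lemma qcomputable_min:
  assumes "qcomputable F" "qcomputable G"
  shows "qcomputable (\<lambda>x. min (F x) (G x))"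
proof -
  have "qcomputable (\<lambda>x. if F x < G x then F x else G x)"
    by (intro qcomputable_if decidable_qless assms)
  also have "(\<lambda>x. if F x < G x then F x else G x) = (\<lambda>x. min (F x) (G x))"
    by (auto simp: min_def fun_eq_iff)
  finally show ?thesis .
qed

lemma qcomputable_abs_diff:
  assumes "qcomputable F" "qcomputable G"
  shows "qcomputable (\<lambda>x. \<bar>F x - G x\<bar>)"
proof -
  obtain f g where fg: "computable f" "computable g"
    "\<And>x. F x = qval (f x)" "\<And>x. G x = qval (g x)"
    using assms unfolding qcomputable_def by blast
  \<comment> \<open>Of the two truncated differences one vanishes, so their sum is the absolute
    difference of the cross products.\<close>
  define d where "d x = (fst (f x) * Suc (snd (g x)) - fst (g x) * Suc (snd (f x))) +
     (fst (g x) * Suc (snd (f x)) - fst (f x) * Suc (snd (g x)))" for x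
  have d: "real (d x) = \<bar>real (fst (f x)) * real (Suc (snd (g x))) -
      real (fst (g x)) * real (Suc (snd (f x)))\<bar>" for x
  proof -
    have "real ((m - n) + (n - m)) = \<bar>real m - real n\<bar>" for m n :: nat by linarith
    then show ?thesis unfolding d_def of_nat_mult[symmetric] .
  qed
  show ?thesis
  proof (rule qcomputableI)
    show "computable (\<lambda>x. (d x, snd (f x) + snd (g x) + snd (f x) * snd (g x)))"
      unfolding d_def by (intro computable_intros fg)
    show "\<bar>F x - G x\<bar> = qval (d x, snd (f x) + snd (g x) + snd (f x) * snd (g x))" for x
    proof -
      have "\<bar>a / b - c / d\<bar> = \<bar>a * d - c * b\<bar> / (b * d)" if "0 < b" "0 < d" for a b c d :: real
        using that by (simp add: diff_frac_eq abs_divide)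
      then show ?thesis
        unfolding fg qval_def fst_conv snd_conv Suc_denominator of_nat_mult d by simp
    qed
  qed
qed

lemma qcomputable_divide_Suc:
  assumes "qcomputable F" "computable N"
  shows "qcomputable (\<lambda>x. F x / real (Suc (N x)))"
proof -
  have "qcomputable (\<lambda>x. qval (1, N x))"
    by (intro qcomputable_qval computable_intros assms)
  from qcomputable_mult[OF assms(1) this] show ?thesis by (simp add: qval_def)
qed

lemma qcomputable_divide_numeral:
  assumes "qcomputable F"
  shows "qcomputable (\<lambda>x. F x / numeral n)"
  using qcomputable_divide_Suc[OF assms computable_const[of "pred_numeral n"]]
  by (simp add: numeral_eq_Suc[symmetric] flip: of_nat_Suc)

text \<open>The recursion is carried out on fractions although \<open>H\<close> acts on real values.
  Asking for computability of \<open>H\<close> at \<open>qval\<close> of an arbitrary fraction makes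
  the choice of representation immaterial.\<close>

lemma qcomputable_rec_nat:
  assumes "computable N" "qcomputable A"
    and "qcomputable (\<lambda>t. H (fst t) (qval (fst (snd t))) (snd (snd t)))"
  shows "qcomputable (\<lambda>x. rec_nat (A x) (\<lambda>n v. H n v x) (N x))"
proof -
  obtain a where a: "computable a" "\<And>x. A x = qval (a x)"
    using assms(2) unfolding qcomputable_def by blast
  obtain h where h: "computable h"
    "\<And>t. H (fst t) (qval (fst (snd t))) (snd (snd t)) = qval (h t)"
    using assms(3) unfolding qcomputable_def by blast
  have h': "H n (qval v) x = qval (h (n, v, x))" for n v x
    using h(2)[of "(n, v, x)"] by simp
  have "computable (\<lambda>x. rec_nat (a x) (\<lambda>n v. h (n, v, x)) (N x))"
    using assms(1) a(1) h(1) by (intro computable_rec_nat) simp_all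
  moreover have "rec_nat (A x) (\<lambda>n v. H n v x) n = qval (rec_nat (a x) (\<lambda>n v. h (n, v, x)) n)" for n x
    by (induction n) (simp_all add: a(2) h')
  ultimately show ?thesis by (intro qcomputableI)
qed

lemma qcomputable_power:
  assumes "qcomputable F" "computable N"
  shows "qcomputable (\<lambda>x. F x ^ N x)"
proof -
  have "qcomputable (\<lambda>x. rec_nat 1 (\<lambda>n v. F x * v) (N x))"
    by (intro qcomputable_rec_nat[where H = "\<lambda>n v x. F x * v"] assms qcomputable_1
        qcomputable_mult qcomputable_qval qcomputable_compose[OF assms(1)] computable_intros)
  moreover have "rec_nat 1 (\<lambda>n v. F x * v) n = F x ^ n" for n x
    by (induction n) auto
  ultimately show ?thesis by simp
qed

lemmas qcomputable_intros =
  qcomputable_qval qcomputable_of_nat qcomputable_0 qcomputable_1 qcomputable_numeral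
  qcomputable_add qcomputable_mult qcomputable_if qcomputable_min qcomputable_abs_diff
  qcomputable_divide_Suc qcomputable_divide_numeral qcomputable_power
  decidable_qless

section \<open>Ideal balls, computable maps and reductions\<close>

lemma qcomputable_ideal_center: "computable I \<Longrightarrow> qcomputable (\<lambda>x. ideal_center (I x))"
  unfolding ideal_center_def case_prod_beta
  by (intro qcomputable_intros computable_intros
    computable_compose[OF computable_fst_nat] computable_compose[OF computable_snd_nat])

lemma qcomputable_ideal_radius: "computable I \<Longrightarrow> qcomputable (\<lambda>x. ideal_radius (I x))"
  unfolding ideal_radius_def case_prod_beta
  by (intro qcomputable_intros computable_intros
    computable_compose[OF computable_fst_nat] computable_compose[OF computable_snd_nat])

lemma ideal_center_bounds: "ideal_center i \<in> {0..1}"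
  using range_ideal_center_radius by blast

lemma ideal_index_exists:
  assumes "c \<in> \<rat>" "c \<in> {0..1}" "r \<in> \<rat>" "0 < r"
  obtains i where "ideal_center i = c" "ideal_radius i = r"
proof -
  have "(c, r) \<in> range (\<lambda>i. (ideal_center i, ideal_radius i))"
    unfolding range_ideal_center_radius using assms by auto
  with that show thesis by blast
qed

lemma rational_approximation_01:
  assumes "x \<in> {0..1::real}" "0 < r"
  obtains c where "c \<in> \<rat>" "c \<in> {0..1}" "\<bar>x - c\<bar> < r"
proof (cases "x = 1")
  case True
  with assms that[of 1] show thesis by simp
next
  case False
  then have "x < min 1 (x + r)" using assms by auto
  then obtain c where "c \<in> \<rat>" "x < c" "c < min 1 (x + r)"
    using Rats_dense_in_real by blast
  with assms that[of c] show thesis by auto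
qed

lemma computable_prod_encode:
  assumes "computable F" "computable G"
  shows "computable (\<lambda>x. prod_encode (F x, G x))"
  using computable_enc[OF computable_Pair[OF assms]] by simp

text \<open>Ball \<open>i\<close> is listed for \<open>m\<close> once, at some precision
  \<open>j\<close>, the approximate value at its center together with the Lipschitz bound proves
  that \<open>f\<close> maps it into ball \<open>m\<close>. Every point of the preimage is caught by
  a small enough ball around it.\<close>

lemma computable_map_if_Lipschitz:
  fixes f :: "real \<Rightarrow> real" and L :: nat
  assumes maps: "f \<in> {0..1} \<rightarrow> {0..1}"
    and lip: "\<And>x y :: real. x \<in> {0..1} \<Longrightarrow> y \<in> {0..1} \<Longrightarrow> \<bar>f x - f y\<bar> \<le> L * \<bar>x - y\<bar>"
    and comp: "qcomputable (\<lambda>t. g (fst t) (ideal_center (snd t)))"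
    and approx: "\<And>j x. x \<in> {0..1} \<Longrightarrow> \<bar>g j x - f x\<bar> \<le> (1/2) ^ j"
  shows "computable_map f"
proof -
  define ok where "ok j i m \<longleftrightarrow>
    \<bar>g j (ideal_center i) - ideal_center m\<bar> + (L * ideal_radius i + (1/2) ^ j) < ideal_radius m" for j i m
  define h where "h n m = (if ok (fst (prod_decode n)) (snd (prod_decode n)) m
    then Suc (snd (prod_decode n)) else 0)" for n m
  have "computable (\<lambda>t. h (fst t) (snd t))"
    unfolding h_def ok_def
    by (intro computable_if qcomputable_intros qcomputable_ideal_center qcomputable_ideal_radius
      qcomputable_compose[OF comp, of "\<lambda>t. (_ t, _ t)", simplified] computable_intros
      computable_compose[OF computable_fst_nat] computable_compose[OF computable_snd_nat])
  then obtain p where "\<And>e t. eval e p [enc t] = Some (enc (h (fst t) (snd t)))"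
    unfolding computable_def by blast
  from this[of _ "(n, m)" for n m] have p: "\<And>e n m. eval e p [prod_encode (n, m)] = Some (h n m)"
    by simp
  define I where "I m = {i. \<exists>n. h n m = Suc i}" for m
  have I: "i \<in> I m \<longleftrightarrow> (\<exists>j. ok j i m)" for i m
  proof
    assume "\<exists>j. ok j i m"
    then obtain j where "ok j i m" ..
    then have "h (prod_encode (j, i)) m = Suc i" by (simp add: h_def)
    then show "i \<in> I m" unfolding I_def by blast
  qed (auto simp: I_def h_def split: if_splits)
  have "enumerates (\<lambda>_. 0) (Comp p [Comp pair_prog [Proj 0, Proj 1]]) [m] (I m)" for m
    unfolding enumerates_def
    by (rule exI[of _ "\<lambda>n. h n m"]) (simp add: enumeration_of_def I_def p)
  moreover have "{x \<in> {0..1}. f x \<in> ideal_ball m} = (\<Union>i\<in>I m. ideal_ball i)" for m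
  proof (intro set_eqI iffI)
    fix x assume x: "x \<in> {x \<in> {0..1}. f x \<in> ideal_ball m}"
    \<comment> \<open>The slack \<open>d\<close> is divided into quarters: one for the term
      \<open>L * r\<close>, one for the term \<open>(1/2) ^ j\<close> in \<open>ok\<close>, one for
      moving from \<open>x\<close> to the center \<open>c\<close>, one for replacing
      \<open>f c\<close> by \<open>g j c\<close>. The summand 1 in the denominator of
      \<open>\<rho>\<close> covers \<open>L = 0\<close>.\<close>
    define d where "d = ideal_radius m - \<bar>f x - ideal_center m\<bar>"
    have "0 < d" using x by (simp add: d_def ideal_ball_def dist_real_def abs_minus_commute)
    then obtain j where j: "(1/2) ^ j < d / 4"
      using real_arch_pow_inv[of "d/4" "1/2"] by auto
    define \<rho> where "\<rho> = d / (4 * (real L + 1))"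
    have "0 < \<rho>" using \<open>0 < d\<close> by (simp add: \<rho>_def)
    then obtain r where r: "r \<in> \<rat>" "0 < r" "r < \<rho>" using Rats_dense_in_real by blast
    obtain c where c: "c \<in> \<rat>" "c \<in> {0..1}" "\<bar>x - c\<bar> < r"
      using rational_approximation_01[of x r] x r(2) by auto
    obtain i where i: "ideal_center i = c" "ideal_radius i = r"
      using ideal_index_exists[OF c(1,2) r(1,2)] by blast
    have "L * r \<le> L * \<rho>" using r by (intro mult_left_mono) auto
    also have "\<dots> \<le> d / 4" using \<open>0 < d\<close> by (simp add: \<rho>_def field_simps)
    finally have Lr: "L * r \<le> d / 4" .
    have "\<bar>f x - f c\<bar> \<le> L * \<bar>x - c\<bar>" using lip x c by simp
    also have "\<dots> \<le> L * r" using c by (intro mult_left_mono) auto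
    finally have "\<bar>f x - f c\<bar> \<le> d / 4" using Lr by linarith
    moreover have "\<bar>g j c - f c\<bar> \<le> (1/2) ^ j" using approx c by simp
    moreover have "\<bar>g j c - ideal_center m\<bar> \<le>
        \<bar>g j c - f c\<bar> + \<bar>f x - f c\<bar> + \<bar>f x - ideal_center m\<bar>" by linarith
    moreover have "ideal_radius m = d + \<bar>f x - ideal_center m\<bar>" by (simp add: d_def)
    ultimately have "ok j i m" using Lr j unfolding ok_def i by linarith
    then have "i \<in> I m" using I by blast
    moreover have "x \<in> ideal_ball i"
      using x c by (simp add: ideal_ball_def i dist_real_def abs_minus_commute)
    ultimately show "x \<in> (\<Union>i\<in>I m. ideal_ball i)" by blast
  next
    fix x assume "x \<in> (\<Union>i\<in>I m. ideal_ball i)"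
    then obtain i j where x: "x \<in> ideal_ball i" and ok: "ok j i m" using I by blast
    have x01: "x \<in> {0..1}" and xi: "\<bar>x - ideal_center i\<bar> \<le> ideal_radius i"
      using x by (auto simp: ideal_ball_def dist_real_def)
    have "\<bar>f x - f (ideal_center i)\<bar> \<le> L * \<bar>x - ideal_center i\<bar>"
      using lip x01 ideal_center_bounds by blast
    also have "\<dots> \<le> L * ideal_radius i" using xi by (intro mult_left_mono) auto
    finally have "\<bar>f x - f (ideal_center i)\<bar> \<le> L * ideal_radius i" .
    moreover have "\<bar>g j (ideal_center i) - f (ideal_center i)\<bar> \<le> (1/2) ^ j"
      using approx ideal_center_bounds by blast
    ultimately have "\<bar>f x - ideal_center m\<bar> < ideal_radius m"
      using ok unfolding ok_def by linarith
    moreover have "f x \<in> {0..1}" using maps x01 by blast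
    ultimately show "x \<in> {x \<in> {0..1}. f x \<in> ideal_ball m}"
      using x01 by (simp add: ideal_ball_def dist_real_def abs_minus_commute)
  qed
  ultimately show ?thesis unfolding computable_map_def using maps by blast
qed

text \<open>The map sending \<open>i\<close> to \<open>b (prod_encode (c, i))\<close> many-one
  reduces the outer collection of \<open>K'\<close> to that of \<open>K\<close>. Hence
  \<open>i\<close> is output when the given enumeration yields this number; the step counter codes a
  pair of a time and a candidate \<open>i\<close>, so every candidate is tested at every
  time.\<close>

lemma outer_reducible_if_visit:
  assumes b: "computable b"
    and K: "\<And>k. b k \<in> outer_collection K \<longleftrightarrow> finite {n. visit n = Suc k}"
    and K': "Pi_compact 2 K'"
  shows "outer_reducible K' K"
proof -
  obtain c where "\<And>i. i \<in> outer_collection K' \<longleftrightarrow> finite {n. visit n = Suc (prod_encode (c, i))}"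
    using K' Sigma_set_2_visit unfolding Pi_compact_def by blast
  then have c: "i \<in> outer_collection K' \<longleftrightarrow> b (prod_encode (c, i)) \<in> outer_collection K" for i
    by (simp add: K)
  define h where "h a n = (if a = Suc (b (prod_encode (c, snd (prod_decode n))))
    then Suc (snd (prod_decode n)) else 0)" for a n
  have "computable (\<lambda>t. h (fst t) (snd t))"
    unfolding h_def
    by (intro computable_intros computable_compose[OF b] computable_prod_encode
      computable_compose[OF computable_snd_nat])
  then obtain p where "\<And>e t. eval e p [enc t] = Some (enc (h (fst t) (snd t)))"
    unfolding computable_def by blast
  from this[of _ "(a, n)" for a n] have p: "\<And>e a n. eval e p [prod_encode (a, n)] = Some (h a n)"
    by simp
  define q where "q = Comp p [Comp pair_prog [Comp Query [fst_prog], Proj 0]]"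
  have "enumerates e q [] (outer_collection K')" if e: "enumeration_of e (outer_collection K)" for e
    unfolding enumerates_def
  proof (intro exI conjI allI)
    show "eval e q [n] = Some (h (e (fst (prod_decode n))) n)" for n
      by (simp add: q_def p)
    have "i \<in> outer_collection K' \<longleftrightarrow> (\<exists>n. h (e (fst (prod_decode n))) n = Suc i)" for i
    proof
      assume "i \<in> outer_collection K'"
      then obtain t where "e t = Suc (b (prod_encode (c, i)))"
        using e unfolding c enumeration_of_def by blast
      then have "h (e (fst (prod_decode (prod_encode (t, i))))) (prod_encode (t, i)) = Suc i"
        by (simp add: h_def)
      then show "\<exists>n. h (e (fst (prod_decode n))) n = Suc i" by blast
    next
      assume "\<exists>n. h (e (fst (prod_decode n))) n = Suc i"
      then obtain t where "e t = Suc (b (prod_encode (c, i)))"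
        by (auto simp: h_def split: if_splits)
      then show "i \<in> outer_collection K'"
        using e unfolding c enumeration_of_def by blast
    qed
    then show "enumeration_of (\<lambda>n. h (e (fst (prod_decode n))) n) (outer_collection K')"
      unfolding enumeration_of_def by blast
  qed
  then show ?thesis unfolding outer_reducible_def by blast
qed

section \<open>Limit sets and tent-like maps\<close>

lemma omega_limitD: "y \<in> omega_limit f x \<Longrightarrow> open U \<Longrightarrow> y \<in> U \<Longrightarrow> infinite {n. (f ^^ n) x \<in> U}"
  by (simp add: omega_limit_def)

text \<open>By compactness, a closed ball misses the limit set iff the orbit eventually keeps a
  fixed positive distance from it. A single number \<open>y\<close> serves as the time bound and,
  through \<open>(1/2) ^ y\<close>, as the margin, which leaves one existential and one universal
  quantifier over a decidable matrix.\<close>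

lemma Sigma_set_2_outer_omega_limit:
  fixes u :: "nat \<Rightarrow> real"
  assumes orbit: "\<And>n. (f ^^ n) a \<in> {0..1}"
    and u: "qcomputable u" "\<And>n. \<bar>u n - (f ^^ n) a\<bar> \<le> (1/2) ^ n"
  shows "Sigma_set 2 (outer_collection (omega_limit f a))"
proof -
  define P where "P z y i \<longleftrightarrow> (y \<le> z \<longrightarrow>
    ideal_radius i + (1/2) ^ y < \<bar>u z - ideal_center i\<bar>)" for z y i
  have "decidable (\<lambda>t. P (fst t) (fst (snd t)) (snd (snd t)))"
    unfolding P_def
    by (intro decidable_imp decidable_le qcomputable_intros qcomputable_ideal_center
      qcomputable_ideal_radius qcomputable_compose[OF u(1)] computable_intros)
  then have dec: "decidable_rel 3 {[z, y, i] | z y i. P z y i}"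
    by (rule decidable_rel_3I)
  have "i \<in> outer_collection (omega_limit f a) \<longleftrightarrow> (\<exists>y. \<forall>z. P z y i)" for i
  proof
    assume "\<exists>y. \<forall>z. P z y i"
    then obtain y where y: "\<And>z. P z y i" by blast
    have False if p: "p \<in> ideal_cball i" "p \<in> omega_limit f a" for p
    proof -
      \<comment> \<open>Half of the margin \<open>(1/2) ^ y\<close> pays for the distance to
        \<open>p\<close>, the other half for the error of \<open>u\<close> at times from
        \<open>Suc y\<close> on.\<close>
      have "infinite {n. (f ^^ n) a \<in> ball p ((1/2) ^ Suc y)}"
        by (rule omega_limitD[OF p(2)]) simp_all
      then obtain n where n: "Suc y \<le> n" "(f ^^ n) a \<in> ball p ((1/2) ^ Suc y)"
        unfolding infinite_nat_iff_unbounded_le by auto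
      have "(1/2 :: real) ^ n \<le> (1/2) ^ Suc y"
        using n(1) by (intro power_decreasing) auto
      moreover have "\<bar>p - (f ^^ n) a\<bar> < (1/2) ^ Suc y"
        using n(2) by (simp add: dist_real_def)
      moreover have "\<bar>p - ideal_center i\<bar> \<le> ideal_radius i"
        using p(1) by (simp add: ideal_cball_def dist_real_def abs_minus_commute)
      moreover have "\<bar>u n - ideal_center i\<bar> \<le>
          \<bar>u n - (f ^^ n) a\<bar> + \<bar>p - (f ^^ n) a\<bar> + \<bar>p - ideal_center i\<bar>" by linarith
      moreover have "(1/2 :: real) ^ Suc y + (1/2) ^ Suc y = (1/2) ^ y" by simp
      moreover have "ideal_radius i + (1/2) ^ y < \<bar>u n - ideal_center i\<bar>"
        using y[of n] n(1) by (simp add: P_def)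
      ultimately show False using u(2)[of n] by linarith
    qed
    then show "i \<in> outer_collection (omega_limit f a)"
      unfolding outer_collection_def by blast
  next
    assume i: "i \<in> outer_collection (omega_limit f a)"
    show "\<exists>y. \<forall>z. P z y i"
    proof (rule ccontr)
      assume "\<not> (\<exists>y. \<forall>z. P z y i)"
      \<comment> \<open>The time \<open>s y\<close> is at least \<open>y\<close> and violates the
        margin \<open>(1/2) ^ y\<close>. An accumulation point of the orbit along these times lies
        both in the ball and in the limit set.\<close>
      then obtain s where s: "\<And>y. \<not> P (s y) y i" by metis
      have "seq_compact {0..1::real}" by (intro compact_imp_seq_compact) simp
      then obtain p r where p: "p \<in> {0..1}" "strict_mono r"
        "((\<lambda>y. (f ^^ s y) a) \<circ> r) \<longlonglongrightarrow> p"
        by (rule seq_compactE[where f = "\<lambda>y. (f ^^ s y) a"]) (use orbit in auto)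
      have lim: "(\<lambda>j. (f ^^ s (r j)) a) \<longlonglongrightarrow> p" using p(3) by (simp add: o_def)
      have ge: "j \<le> s (r j)" for j
        using s[of "r j"] seq_suble[OF p(2), of j] by (simp add: P_def)
      have "\<bar>(f ^^ s (r j)) a - ideal_center i\<bar> \<le> ideal_radius i + 2 * (1/2) ^ j" for j
      proof -
        have "\<bar>u (s (r j)) - ideal_center i\<bar> \<le> ideal_radius i + (1/2) ^ r j"
          using s[of "r j"] by (simp add: P_def)
        moreover have "(1/2 :: real) ^ r j \<le> (1/2) ^ j"
          using seq_suble[OF p(2), of j] by (intro power_decreasing) auto
        moreover have "(1/2 :: real) ^ s (r j) \<le> (1/2) ^ j"
          using ge by (intro power_decreasing) auto
        ultimately show ?thesis using u(2)[of "s (r j)"] by linarith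
      qed
      moreover have "(\<lambda>j. \<bar>(f ^^ s (r j)) a - ideal_center i\<bar>) \<longlonglongrightarrow> \<bar>p - ideal_center i\<bar>"
        by (intro tendsto_intros lim)
      moreover have "(\<lambda>j. ideal_radius i + 2 * (1/2) ^ j) \<longlonglongrightarrow> ideal_radius i + 2 * 0"
        by (intro tendsto_intros LIMSEQ_realpow_zero) auto
      ultimately have "\<bar>p - ideal_center i\<bar> \<le> ideal_radius i + 2 * 0"
        by (intro LIMSEQ_le) auto
      then have "p \<in> ideal_cball i"
        using p(1) by (simp add: ideal_cball_def dist_real_def abs_minus_commute)
      moreover have "p \<in> omega_limit f a"
        unfolding omega_limit_def
      proof (intro CollectI allI impI)
        fix U assume "open U" "p \<in> U"
        then obtain J where J: "\<And>j. j \<ge> J \<Longrightarrow> (f ^^ s (r j)) a \<in> U"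
          using lim unfolding tendsto_def eventually_sequentially by blast
        show "infinite {n. (f ^^ n) a \<in> U}"
          unfolding infinite_nat_iff_unbounded_le
        proof
          fix m
          show "\<exists>n\<ge>m. n \<in> {n. (f ^^ n) a \<in> U}"
            using J[of "max m J"] ge[of "max m J"] by (intro exI[of _ "s (r (max m J))"]) auto
        qed
      qed
      ultimately show False using i unfolding outer_collection_def by blast
    qed
  qed
  with dec show ?thesis
    unfolding Sigma_set_2_iff by (intro exI[of _ "{[z, y, i] | z y i. P z y i}"]) simp
qed

lemma closed_omega_limit: "closed (omega_limit f x)"
proof -
  have "- omega_limit f x = \<Union>{U. open U \<and> finite {n. (f ^^ n) x \<in> U}}"
    by (auto simp: omega_limit_def)
  then have "open (- omega_limit f x)" by (simp add: open_Union)
  then show ?thesis by (simp add: closed_def)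
qed

lemma omega_limit_funpow: "omega_limit f ((f ^^ i) x) = omega_limit f x"
proof -
  have "infinite {n. (f ^^ n) ((f ^^ i) x) \<in> U} \<longleftrightarrow> infinite {n. (f ^^ n) x \<in> U}" for U
  proof -
    have "(f ^^ n) ((f ^^ i) x) = (f ^^ (n + i)) x" for n
      by (simp add: funpow_add)
    moreover have "infinite {n. P (n + i)} \<longleftrightarrow> infinite {n. P n}" for P :: "nat \<Rightarrow> bool"
      using eventually_sequentially_seg[of "\<lambda>n. \<not> P n" i]
      by (simp add: cofinite_eq_sequentially[symmetric] eventually_cofinite)
    ultimately show ?thesis by simp
  qed
  then show ?thesis unfolding omega_limit_def by simp
qed

lemma omega_limit_subset:
  assumes "closed C" "\<And>n. (f ^^ n) x \<in> C"
  shows "omega_limit f x \<subseteq> C"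
proof
  fix y assume y: "y \<in> omega_limit f x"
  show "y \<in> C"
  proof (rule ccontr)
    assume "y \<notin> C"
    then have "infinite {n. (f ^^ n) x \<in> - C}"
      using y assms(1) unfolding omega_limit_def by blast
    with assms(2) show False by simp
  qed
qed

text \<open>On the unit interval \<open>\<bar>1 - x\<bar>\<close> is just \<open>1 - x\<close>;
  written this way, the map can be evaluated within nonnegative rationals.\<close>

definition tent :: "real \<Rightarrow> real \<Rightarrow> real" where
  "tent z x = min (min 1 (2 * x)) (min (16 * \<bar>x - 3/4\<bar>) (z + 16 * \<bar>1 - x\<bar>))"

lemma min_diff_le: "\<bar>a - c\<bar> \<le> e \<Longrightarrow> \<bar>b - d\<bar> \<le> e \<Longrightarrow> \<bar>min a b - min c d\<bar> \<le> (e::real)"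
  by (simp add: min_def abs_le_iff)

lemma tent_Lipschitz: "\<bar>tent z x - tent z y\<bar> \<le> 16 * \<bar>x - y\<bar>"
  unfolding tent_def by (intro min_diff_le; smt (verit))

lemma tent_perturb: "\<bar>tent z x - tent z' x\<bar> \<le> \<bar>z - z'\<bar>"
  unfolding tent_def by (intro min_diff_le; smt (verit))

text \<open>Each step multiplies the accumulated error by at most 16 and adds at most one parameter
  error, hence the base 17.\<close>

lemma tent_funpow_perturb: "\<bar>(tent z ^^ n) x - (tent z' ^^ n) x\<bar> \<le> 17 ^ n * \<bar>z - z'\<bar>"
proof (induction n)
  case (Suc n)
  let ?a = "(tent z ^^ n) x" and ?b = "(tent z' ^^ n) x"
  have le: "\<bar>z - z'\<bar> \<le> 17 ^ n * \<bar>z - z'\<bar>"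
    using mult_right_mono[OF one_le_power[of "17::real" n], of "\<bar>z - z'\<bar>"] by simp
  have "\<bar>tent z ?a - tent z' ?b\<bar> \<le> 16 * \<bar>?a - ?b\<bar> + \<bar>z - z'\<bar>"
    using tent_Lipschitz[of z ?a ?b] tent_perturb[of z ?b z'] by linarith
  also have "\<dots> \<le> 16 * (17 ^ n * \<bar>z - z'\<bar>) + 17 ^ n * \<bar>z - z'\<bar>"
    using Suc.IH le by (intro add_mono mult_left_mono) simp_all
  finally show ?case by (simp add: algebra_simps)
qed simp

lemma tent_maps: "0 \<le> z \<Longrightarrow> tent z \<in> {0..1} \<rightarrow> {0..1}"
  by (auto simp: tent_def)

lemma tent_funpow_maps: "0 \<le> z \<Longrightarrow> x \<in> {0..1} \<Longrightarrow> (tent z ^^ n) x \<in> {0..1}"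
  by (induction n) (auto simp del: atLeastAtMost_iff intro: funcset_mem[OF tent_maps])

lemma continuous_tent: "continuous_on UNIV (tent z)"
  unfolding tent_def by (intro continuous_intros)

lemma continuous_tent_funpow: "continuous_on UNIV (tent z ^^ n)"
proof (induction n)
  case (Suc n)
  show ?case
    unfolding funpow.simps
    by (intro continuous_on_compose Suc.IH continuous_on_subset[OF continuous_tent]) auto
qed (simp add: id_def)

lemma tent_1: "0 \<le> z \<Longrightarrow> z \<le> 1 \<Longrightarrow> tent z 1 = z"
  by (simp add: tent_def)

lemma tent_double: "0 \<le> z \<Longrightarrow> 0 \<le> x \<Longrightarrow> x \<le> 1/2 \<Longrightarrow> tent z x = 2 * x"
  by (simp add: tent_def min_def abs_if)

text \<open>In this neighborhood the chosen term is at most 1 and the other three terms are at least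
  1.\<close>

lemma tent_near: "0 \<le> z \<Longrightarrow> \<bar>x - 3/4\<bar> \<le> 1/16 \<Longrightarrow> tent z x = 16 * \<bar>x - 3/4\<bar>"
  by (simp add: tent_def min_def abs_if split: if_splits)

lemma tent_double_funpow:
  assumes "0 \<le> z" "0 \<le> x" "2 ^ n * x \<le> 1"
  shows "(tent z ^^ n) x = 2 ^ n * x"
  using assms(3)
proof (induction n)
  case (Suc n)
  then have "2 ^ n * x \<le> 1/2" by simp
  with Suc.IH tent_double[OF assms(1), of "2 ^ n * x"] assms(2) show ?case by simp
qed simp

section \<open>The null set of points whose orbit never reaches 1\<close>

definition avoiding :: "real \<Rightarrow> real set" where
  "avoiding z = {x \<in> {0..1}. \<forall>n. (tent z ^^ n) x \<noteq> 1}"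

lemma borel_avoiding: "avoiding z \<in> sets borel"
proof -
  have "open ((tent z ^^ n) -` (- {1}))" for n
    using continuous_on_open_vimage[of UNIV "tent z ^^ n"] continuous_tent_funpow by auto
  then have "(\<Inter>n. (tent z ^^ n) -` (- {1})) \<in> sets borel"
    by (intro sets.countable_INT) auto
  moreover have "avoiding z = {0..1} \<inter> (\<Inter>n. (tent z ^^ n) -` (- {1}))"
    unfolding avoiding_def by auto
  ultimately show ?thesis by simp
qed

lemma tent_avoiding: 
  assumes "0 \<le> z" "x \<in> avoiding z"
  shows "tent z x \<in> avoiding z"
proof -
  have "(tent z ^^ n) (tent z x) \<noteq> 1" for n
    using assms(2) unfolding avoiding_def
    by (auto dest: spec[of _ "Suc n"] simp: funpow_Suc_right simp del: funpow.simps)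
  then show ?thesis using assms tent_maps unfolding avoiding_def by blast
qed

lemma borel_affine_image:
  assumes S: "S \<in> sets borel" and m: "m \<noteq> 0"
  shows "(\<lambda>x::real. m * x + d) ` S \<in> sets borel"
proof -
  have "(\<lambda>x. m * x + d) ` S = (\<lambda>y. (y - d) / m) -` S"
    using m by (force simp: image_iff)
  moreover have "(\<lambda>y. (y - d) / m) \<in> borel_measurable borel" by measurable
  ultimately show ?thesis using measurable_sets[of "\<lambda>y. (y - d) / m" borel borel S] S by simp
qed

lemma emeasure_affine_image:
  assumes S: "S \<in> sets borel" and m: "m \<noteq> 0"
  shows "emeasure lborel ((\<lambda>x::real. m * x + d) ` S) = ennreal \<bar>m\<bar> * emeasure lborel S"
proof -
  let ?T = "(\<lambda>x. m * x + d) ` S"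
  have T: "?T \<in> sets borel" using assms by (rule borel_affine_image)
  have "emeasure lborel ?T = (\<integral>\<^sup>+x. indicator ?T x \<partial>lborel)" using T by simp
  also have "\<dots> = \<bar>m\<bar> * (\<integral>\<^sup>+x. indicator ?T (d + m * x) \<partial>lborel)"
    using T m by (intro nn_integral_real_affine) auto
  also have "(\<lambda>x. indicator ?T (d + m * x)) = (indicator S :: real \<Rightarrow> ennreal)"
    using m by (auto simp: fun_eq_iff indicator_def image_iff)
  also have "(\<integral>\<^sup>+x. indicator S x \<partial>lborel) = emeasure lborel S" using S by simp
  finally show ?thesis .
qed

text \<open>The set is forward invariant and the constant branch 1 is excluded on it, so each of its
  points is the image of another one under the inverse of one of the four affine branches. These
  inverses have slopes of size \<open>1/2\<close>, \<open>1/16\<close>, \<open>1/16\<close>,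
  \<open>1/16\<close>, with sum \<open>11/16 < 1\<close>.\<close>

lemma avoiding_null:
  assumes "0 \<le> z"
  shows "avoiding z \<in> null_sets lebesgue"
proof -
  let ?N = "avoiding z"
  define h where "h m d = (\<lambda>x::real. m * x + d) ` ?N" for m d
  have h: "h m d \<in> sets borel" "emeasure lborel (h m d) = ennreal \<bar>m\<bar> * emeasure lborel ?N"
    if "m \<noteq> 0" for m d
    unfolding h_def using that borel_avoiding by (auto intro: borel_affine_image emeasure_affine_image)
  have cover: "?N \<subseteq> (h (1/2) 0 \<union> h (-1/16) (3/4)) \<union> (h (1/16) (3/4) \<union> h (-1/16) (1 + z/16))"
  proof
    fix x assume x: "x \<in> ?N"
    then have x01: "x \<in> {0..1}" and ne: "tent z x \<noteq> 1"
      unfolding avoiding_def by (auto dest: spec[of _ "1::nat"])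
    have "tent z x \<in> {1, 2 * x, 16 * (3/4 - x), 16 * (x - 3/4), z + 16 * (1 - x)}"
      using x01 by (auto simp: tent_def min_def abs_if)
    with ne have "x = 1/2 * tent z x + 0 \<or> x = -1/16 * tent z x + 3/4 \<or>
        x = 1/16 * tent z x + 3/4 \<or> x = -1/16 * tent z x + (1 + z/16)"
      by (simp add: field_simps) linarith
    with tent_avoiding[OF assms x]
    show "x \<in> (h (1/2) 0 \<union> h (-1/16) (3/4)) \<union> (h (1/16) (3/4) \<union> h (-1/16) (1 + z/16))"
      unfolding h_def by blast
  qed
  \<comment> \<open>Only a finite measure is forced to vanish by being at most \<open>11/16\<close>
    of itself.\<close>
  have fin: "emeasure lborel ?N \<noteq> \<infinity>"
  proof -
    have "emeasure lborel ?N \<le> emeasure lborel {0..1::real}"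
      by (intro emeasure_mono) (auto simp: avoiding_def)
    then show ?thesis by (auto simp: top_unique)
  qed
  have sum4: "ennreal a + ennreal b + (ennreal c + ennreal d) = ennreal (a + b + (c + d))"
    if "0 \<le> a" "0 \<le> b" "0 \<le> c" "0 \<le> d" for a b c d
    using that by simp
  have "emeasure lborel ?N \<le>
      emeasure lborel ((h (1/2) 0 \<union> h (-1/16) (3/4)) \<union> (h (1/16) (3/4) \<union> h (-1/16) (1 + z/16)))"
    using cover h(1) by (intro emeasure_mono) auto
  also have "\<dots> \<le> (emeasure lborel (h (1/2) 0) + emeasure lborel (h (-1/16) (3/4))) +
      (emeasure lborel (h (1/16) (3/4)) + emeasure lborel (h (-1/16) (1 + z/16)))"
    using h(1) by (intro order_trans[OF emeasure_subadditive] add_mono emeasure_subadditive) auto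
  also have "\<dots> = (ennreal (1/2) + ennreal (1/16) + (ennreal (1/16) + ennreal (1/16))) * emeasure lborel ?N"
    by (simp add: h(2) distrib_right)
  also have "ennreal (1/2) + ennreal (1/16) + (ennreal (1/16) + ennreal (1/16)) =
      ennreal (1/2 + 1/16 + (1/16 + 1/16))"
    by (rule sum4) simp_all
  also have "1/2 + 1/16 + (1/16 + 1/16) = (11/16 :: real)" by simp
  finally have "emeasure lborel ?N \<le> ennreal (11/16) * emeasure lborel ?N" .
  then have "emeasure lborel ?N = 0"
    using fin by (cases "emeasure lborel ?N") (auto simp: ennreal_mult[symmetric] top_unique)
  then have "?N \<in> null_sets lborel" using borel_avoiding by auto
  then show ?thesis by (rule null_sets_completionI)
qed

section \<open>The orbit that realizes the universal sequence\<close>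

text \<open>
  Follow the orbit of \<open>x\<close> backwards: doubling from \<open>backstep n x\<close> leads to
  \<open>3/4 - (1/2) ^ (visit n + 4) * (3/4 + x/16)\<close>, whose image doubles up to \<open>3/4 + x/16\<close>,
  which is mapped to \<open>x\<close>. The absolute value only serves computability on nonnegative rationals.
\<close>

definition backstep :: "nat \<Rightarrow> real \<Rightarrow> real" where
  "backstep n x = (1/2) ^ Suc n * \<bar>3/4 - (1/2) ^ (visit n + 4) * (3/4 + x/16)\<bar>"

text \<open>The infinite backward composition of \<open>backstep n\<close>,
  \<open>backstep (Suc n)\<close> and so on, cut off after \<open>j\<close> maps and started at 0.
  Since the maps contract, the starting value is forgotten in the limit.\<close>

primrec seed_approx :: "nat \<Rightarrow> nat \<Rightarrow> real" where
  "seed_approx 0 n = 0"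
| "seed_approx (Suc j) n = backstep n (seed_approx j (Suc n))"

lemma backstep_bounds:
  assumes "0 \<le> x" "x \<le> 1"
  shows "0 \<le> backstep n x" "backstep n x \<le> 1/2"
proof -
  have p: "(1/2 :: real) ^ Suc n \<le> 1/2" "(1/2 :: real) ^ (visit n + 4) \<le> 1/16"
    using power_decreasing[of 1 "Suc n" "1/2 :: real"]
      power_decreasing[of 4 "visit n + 4" "1/2 :: real"] by (simp_all add: eval_nat_numeral)
  have "(1/2 :: real) ^ (visit n + 4) * (3/4 + x/16) \<le> 1/16 * 1"
    using assms by (intro mult_mono p) auto
  moreover have "0 \<le> (1/2 :: real) ^ (visit n + 4) * (3/4 + x/16)"
    using assms by simp
  ultimately have "\<bar>3/4 - (1/2) ^ (visit n + 4) * (3/4 + x/16)\<bar> \<le> 1" by linarith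
  then have "backstep n x \<le> 1/2 * 1"
    unfolding backstep_def by (intro mult_mono p) auto
  then show "backstep n x \<le> 1/2" by simp
  show "0 \<le> backstep n x" by (simp add: backstep_def)
qed

lemma backstep_contracts: "\<bar>backstep n x - backstep n y\<bar> \<le> 1/4 * \<bar>x - y\<bar>"
proof -
  let ?c = "(1/2 :: real) ^ (visit n + 4)"
  have p: "(1/2 :: real) ^ Suc n \<le> 1" "?c \<le> 1"
    by (intro power_le_one; simp)+
  have "\<bar>\<bar>3/4 - ?c * (3/4 + x/16)\<bar> - \<bar>3/4 - ?c * (3/4 + y/16)\<bar>\<bar> \<le> \<bar>?c * (y/16 - x/16)\<bar>"
    by (rule order_trans[OF abs_triangle_ineq3]) (simp add: algebra_simps)
  also have "\<dots> \<le> 1 * (1/16 * \<bar>x - y\<bar>)"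
  proof -
    have "\<bar>y/16 - x/16\<bar> = 1/16 * \<bar>x - y\<bar>"
      by (simp add: diff_divide_distrib[symmetric] abs_minus_commute)
    then show ?thesis unfolding abs_mult using p by (intro mult_mono) auto
  qed
  finally have "\<bar>\<bar>3/4 - ?c * (3/4 + x/16)\<bar> - \<bar>3/4 - ?c * (3/4 + y/16)\<bar>\<bar> \<le> 1/4 * \<bar>x - y\<bar>" by simp
  then have "(1/2) ^ Suc n * \<bar>\<bar>3/4 - ?c * (3/4 + x/16)\<bar> - \<bar>3/4 - ?c * (3/4 + y/16)\<bar>\<bar> \<le> 1 * (1/4 * \<bar>x - y\<bar>)"
    by (intro mult_mono p) auto
  then show ?thesis
    unfolding backstep_def right_diff_distrib[symmetric] abs_mult by simp
qed

lemma seed_approx_bounds: "0 \<le> seed_approx j n \<and> seed_approx j n \<le> 1/2"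
proof (induction j arbitrary: n)
  case (Suc j)
  have "seed_approx j (Suc n) \<le> 1" using Suc.IH[of "Suc n"] by linarith
  with Suc.IH[of "Suc n"] show ?case
    using backstep_bounds[of "seed_approx j (Suc n)" n] by simp
qed simp

lemma seed_approx_Cauchy: "j \<le> m \<Longrightarrow> \<bar>seed_approx m n - seed_approx j n\<bar> \<le> (1/4) ^ j"
proof (induction j arbitrary: m n)
  case 0
  then show ?case using seed_approx_bounds[of m n] by simp
next
  case (Suc j)
  then obtain m' where m: "m = Suc m'" "j \<le> m'" by (cases m) auto
  have "\<bar>seed_approx m n - seed_approx (Suc j) n\<bar> \<le>
      1/4 * \<bar>seed_approx m' (Suc n) - seed_approx j (Suc n)\<bar>"
    unfolding m seed_approx.simps by (rule backstep_contracts)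
  also have "\<dots> \<le> 1/4 * (1/4) ^ j" using Suc.IH[OF m(2)] by (intro mult_left_mono) auto
  finally show ?case by simp
qed

lemma seed_approx_convergent: "convergent (\<lambda>j. seed_approx j n)"
proof -
  have "Cauchy (\<lambda>j. seed_approx j n)"
  proof (rule metric_CauchyI)
    fix e :: real assume "0 < e"
    then obtain J where J: "(1/4) ^ J < e / 2"
      using real_arch_pow_inv[of "e/2" "1/4"] by auto
    have "dist (seed_approx a n) (seed_approx b n) < e" if "J \<le> a" "J \<le> b" for a b
      using seed_approx_Cauchy[OF that(1), of n] seed_approx_Cauchy[OF that(2), of n] J
      unfolding dist_real_def by linarith
    then show "\<exists>J. \<forall>a\<ge>J. \<forall>b\<ge>J. dist (seed_approx a n) (seed_approx b n) < e" by blast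
  qed
  then show ?thesis by (rule Cauchy_convergent)
qed

definition seed :: "nat \<Rightarrow> real" where "seed n = lim (\<lambda>j. seed_approx j n)"

lemma seed_approx_tendsto: "(\<lambda>j. seed_approx j n) \<longlonglongrightarrow> seed n"
  unfolding seed_def using seed_approx_convergent by (simp add: convergent_LIMSEQ_iff)

lemma seed_bounds: "0 \<le> seed n" "seed n \<le> 1/2"
  using LIMSEQ_le_const[OF seed_approx_tendsto[of n]] LIMSEQ_le_const2[OF seed_approx_tendsto[of n]]
    seed_approx_bounds by blast+

text \<open>An explicit rate of convergence is what makes the limit usable as a computable
  parameter.\<close>

lemma seed_approx_error: "\<bar>seed n - seed_approx j n\<bar> \<le> (1/4) ^ j"
proof (rule LIMSEQ_le_const2)
  show "(\<lambda>m. \<bar>seed_approx m n - seed_approx j n\<bar>) \<longlonglongrightarrow> \<bar>seed n - seed_approx j n\<bar>"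
    by (intro tendsto_intros seed_approx_tendsto)
qed (use seed_approx_Cauchy in blast)

lemma seed_eq_backstep: "seed n = backstep n (seed (Suc n))"
proof -
  have "(\<lambda>j. seed_approx (Suc j) n) \<longlonglongrightarrow> backstep n (seed (Suc n))"
    unfolding seed_approx.simps backstep_def by (intro tendsto_intros seed_approx_tendsto) auto
  moreover have "(\<lambda>j. seed_approx (Suc j) n) \<longlonglongrightarrow> seed n"
    by (rule LIMSEQ_Suc[OF seed_approx_tendsto])
  ultimately show ?thesis using LIMSEQ_unique by blast
qed

text \<open>The passages near \<open>3/4\<close>: doubling leads from \<open>seed n\<close> to
  \<open>left_pt n\<close>, whose image doubles up to \<open>right_pt (Suc n)\<close>, which is
  mapped to \<open>seed (Suc n)\<close>.\<close>

definition right_pt :: "nat \<Rightarrow> real" where "right_pt n = 3/4 + seed n / 16"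
definition left_pt :: "nat \<Rightarrow> real" where
  "left_pt n = 3/4 - (1/2) ^ (visit n + 4) * right_pt (Suc n)"

lemma right_pt_bounds: "3/4 \<le> right_pt n" "right_pt n \<le> 13/16"
  using seed_bounds[of n] by (auto simp: right_pt_def)

lemma left_pt_offset:
  "0 < (1/2) ^ (visit n + 4) * right_pt (Suc n)" "(1/2) ^ (visit n + 4) * right_pt (Suc n) \<le> 1/16"
proof -
  have "(1/2 :: real) ^ (visit n + 4) \<le> 1/16"
    using power_decreasing[of 4 "visit n + 4" "1/2 :: real"] by (simp add: eval_nat_numeral)
  then have "(1/2) ^ (visit n + 4) * right_pt (Suc n) \<le> 1/16 * 1"
    using right_pt_bounds[of "Suc n"] by (intro mult_mono) auto
  then show "(1/2) ^ (visit n + 4) * right_pt (Suc n) \<le> 1/16" by simp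
  show "0 < (1/2) ^ (visit n + 4) * right_pt (Suc n)"
    using right_pt_bounds[of "Suc n"] by simp
qed

lemma left_pt_bounds: "1/2 \<le> left_pt n" "left_pt n \<le> 3/4"
  using left_pt_offset[of n] by (auto simp: left_pt_def)

lemma seed_eq: "seed n = (1/2) ^ Suc n * left_pt n"
  using left_pt_bounds(1)[of n]
  by (subst seed_eq_backstep) (simp add: backstep_def left_pt_def right_pt_def)

section \<open>The orbit of 1, cut into blocks\<close>

abbreviation seed_tent :: "real \<Rightarrow> real" where "seed_tent \<equiv> tent (seed 0)"

text \<open>From \<open>seed n\<close> to \<open>seed (Suc n)\<close> there are \<open>Suc n\<close>
  doublings up to \<open>left_pt n\<close>, one step across, \<open>visit n\<close> doublings up to
  \<open>right_pt (Suc n)\<close>, and one step down. The first block starts at time 1 because time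
  0 is the point 1 itself.\<close>

definition block_length :: "nat \<Rightarrow> nat" where "block_length n = n + visit n + 3"

primrec block_start :: "nat \<Rightarrow> nat" where
  "block_start 0 = 1"
| "block_start (Suc n) = block_start n + block_length n"

lemma funpow_seed_double: "m \<le> Suc n \<Longrightarrow> (seed_tent ^^ m) (seed n) = (1/2) ^ (Suc n - m) * left_pt n"
proof -
  assume m: "m \<le> Suc n"
  have p: "2 ^ m * seed n = (1/2) ^ (Suc n - m) * left_pt n"
    using m by (subst seed_eq) (simp add: power_diff power_divide)
  have "(1/2) ^ (Suc n - m) * left_pt n \<le> 1 * 1"
    using left_pt_bounds[of n] by (intro mult_mono power_le_one) auto
  then show "(seed_tent ^^ m) (seed n) = (1/2) ^ (Suc n - m) * left_pt n"
    using tent_double_funpow[of "seed 0" "seed n" m] seed_bounds p by simp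
qed

lemma seed_tent_left_pt: "seed_tent (left_pt n) = (1/2) ^ visit n * right_pt (Suc n)"
proof -
  have "seed_tent (left_pt n) = 16 * \<bar>left_pt n - 3/4\<bar>"
    using left_pt_offset[of n] seed_bounds by (intro tent_near) (auto simp: left_pt_def)
  also have "\<dots> = 16 * ((1/2) ^ (visit n + 4) * right_pt (Suc n))"
    using left_pt_offset[of n] by (simp add: left_pt_def)
  finally show ?thesis by (simp add: power_add eval_nat_numeral)
qed

lemma funpow_left_pt:
  assumes m: "m \<le> visit n"
  shows "(seed_tent ^^ Suc m) (left_pt n) = (1/2) ^ (visit n - m) * right_pt (Suc n)"
proof -
  have p: "2 ^ m * ((1/2) ^ visit n * right_pt (Suc n)) = (1/2) ^ (visit n - m) * right_pt (Suc n)"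
    using m by (simp add: power_diff power_divide)
  have "(1/2) ^ (visit n - m) * right_pt (Suc n) \<le> 1 * 1"
    using right_pt_bounds[of "Suc n"] by (intro mult_mono power_le_one) auto
  then have "(seed_tent ^^ m) ((1/2) ^ visit n * right_pt (Suc n)) = (1/2) ^ (visit n - m) * right_pt (Suc n)"
    using tent_double_funpow[of "seed 0" "(1/2) ^ visit n * right_pt (Suc n)" m]
      seed_bounds right_pt_bounds(1)[of "Suc n"] p by simp
  then show ?thesis by (simp add: funpow_Suc_right seed_tent_left_pt del: funpow.simps)
qed

lemma seed_tent_right_pt: "seed_tent (right_pt n) = seed n"
proof -
  have "seed_tent (right_pt n) = 16 * \<bar>right_pt n - 3/4\<bar>"
    using seed_bounds[of n] seed_bounds[of 0] by (intro tent_near) (auto simp: right_pt_def)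
  then show ?thesis using seed_bounds[of n] by (simp add: right_pt_def)
qed

lemma funpow_block_start: "(seed_tent ^^ block_start n) 1 = seed n"
proof (induction n)
  case 0
  show ?case using seed_bounds[of 0] by (simp add: tent_1)
next
  case (Suc n)
  have "block_start (Suc n) = Suc (Suc (visit n) + (Suc n + block_start n))"
    by (simp add: block_length_def)
  then have "(seed_tent ^^ block_start (Suc n)) 1 = seed_tent ((seed_tent ^^ Suc (visit n)) ((seed_tent ^^ Suc n) ((seed_tent ^^ block_start n) 1)))"
    by (simp only: funpow.simps(2) funpow_add o_apply)
  also have "\<dots> = seed (Suc n)"
    using funpow_seed_double[of "Suc n" n] funpow_left_pt[of "visit n" n]
    by (simp only: Suc.IH le_refl) (simp add: seed_tent_right_pt)
  finally show ?case .
qed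

lemma funpow_left_time: "(seed_tent ^^ (block_start n + Suc n)) 1 = left_pt n"
  unfolding add.commute[of "block_start n"] funpow_add o_apply funpow_block_start
  using funpow_seed_double[of "Suc n" n] by simp

text \<open>A point that still has to double lies below \<open>1/2\<close>, and doubling ends either
  at \<open>left_pt n\<close> or at \<open>right_pt (Suc n)\<close>, which is at least
  \<open>3/4\<close>. So within a block only \<open>left_pt n\<close> can come close to a
  target.\<close>

lemma block_orbit:
  assumes "m < block_length n"
  shows "(seed_tent ^^ (block_start n + m)) 1 < 1/2 \<or> (seed_tent ^^ (block_start n + m)) 1 = left_pt n \<or>
    3/4 \<le> (seed_tent ^^ (block_start n + m)) 1"
proof -
  have eq: "(seed_tent ^^ (block_start n + m)) 1 = (seed_tent ^^ m) (seed n)"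
    by (simp add: add.commute[of "block_start n"] funpow_add funpow_block_start)
  have half: "(1/2 :: real) ^ k * x < 1/2" if "0 < k" "0 < x" "x < 1" for k x
  proof -
    have "(1/2 :: real) ^ k * x \<le> 1/2 * x"
      using that power_decreasing[of 1 k "1/2 :: real"] by (intro mult_right_mono) auto
    then show ?thesis using that by linarith
  qed
  consider "m < Suc n" | "m = Suc n" | k where "m = Suc k + Suc n" "k \<le> visit n"
  proof (cases "m \<le> Suc n")
    case False
    with assms have "m = Suc (m - Suc (Suc n)) + Suc n" "m - Suc (Suc n) \<le> visit n"
      by (auto simp: block_length_def)
    then show thesis by (rule that(3))
  qed (use that in linarith)
  then show ?thesis
  proof cases
    case 1
    then show ?thesis
      using funpow_seed_double[of m n] half[of "Suc n - m" "left_pt n"] left_pt_bounds[of n]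
      unfolding eq by simp
  next
    case 2
    then show ?thesis using funpow_seed_double[of m n] unfolding eq by simp
  next
    case 3
    have "(seed_tent ^^ m) (seed n) = (seed_tent ^^ Suc k) ((seed_tent ^^ Suc n) (seed n))"
      unfolding 3(1) funpow_add by simp
    also have "\<dots> = (1/2) ^ (visit n - k) * right_pt (Suc n)"
      using funpow_seed_double[of "Suc n" n] funpow_left_pt[of k n] 3(2) by simp
    finally have "(seed_tent ^^ m) (seed n) = (1/2) ^ (visit n - k) * right_pt (Suc n)" .
    then show ?thesis
      using half[of "visit n - k" "right_pt (Suc n)"] right_pt_bounds[of "Suc n"]
      unfolding eq by (cases "k = visit n") (use 3(2) in auto)
  qed
qed

lemma strict_mono_block_start: "strict_mono block_start"
  by (rule strict_monoI_Suc) (simp add: block_length_def)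

lemma block_exists:
  assumes "0 < i"
  obtains n m where "i = block_start n + m" "m < block_length n"
proof -
  have "\<exists>n m. i = block_start n + m \<and> m < block_length n" 
    using assms
  proof (induction i rule: nat_induct_non_zero)
    case 1
    show ?case by (rule exI[of _ 0], rule exI[of _ 0]) (simp add: block_length_def)
  next
    case (Suc i)
    then obtain n m where nm: "i = block_start n + m" "m < block_length n" by blast
    show ?case
    proof (cases "Suc m < block_length n")
      case True
      with nm show ?thesis by (intro exI[of _ n] exI[of _ "Suc m"]) simp
    next
      case False
      with nm show ?thesis
        by (intro exI[of _ "Suc n"] exI[of _ 0]) (auto simp: block_length_def)
    qed
  qed
  with that show thesis by blast
qed

section \<open>Targets and their membership in the limit set\<close>

definition target :: "nat \<Rightarrow> real" where "target k = 3/4 - (1/2) ^ (k + 4) * (3/4)"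

lemma target_bounds: "45/64 \<le> target k" "target k \<le> 3/4" "0 \<le> target k" "target k \<le> 1"
proof -
  have "0 < (1/2 :: real) ^ (k + 4)" "(1/2 :: real) ^ (k + 4) \<le> 1/16"
    using power_decreasing[of 4 "k + 4" "1/2 :: real"] by (simp_all add: eval_nat_numeral)
  then show "45/64 \<le> target k" "target k \<le> 3/4" "0 \<le> target k" "target k \<le> 1"
    unfolding target_def by linarith+
qed

text \<open>The distance of \<open>left_pt n\<close> to \<open>3/4\<close> is a power of
  \<open>1/2\<close> times a factor between \<open>3/4\<close> and \<open>13/16\<close>. A different
  power changes it by a factor of two or more, which this factor cannot offset; with
  \<open>c = (1/2) ^ (k + 4)\<close> the gap is at least \<open>c / 4\<close>.\<close>

lemma left_pt_far:
  assumes "visit n \<noteq> k"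
  shows "(1/2) ^ (k + 6) \<le> \<bar>left_pt n - target k\<bar>"
proof -
  define c where "c = (1/2 :: real) ^ (k + 4)"
  have c: "0 < c" "(1/2 :: real) ^ (k + 6) = c / 4" by (simp_all add: c_def power_add eval_nat_numeral)
  let ?d = "(1/2 :: real) ^ (visit n + 4)"
  consider "k < visit n" | "visit n < k" using assms by linarith
  then show ?thesis
  proof cases
    case 1
    then have "?d \<le> (1/2) ^ Suc (k + 4)" by (intro power_decreasing) auto
    then have "?d \<le> c / 2" unfolding c_def power_Suc by linarith
    then have "?d * right_pt (Suc n) \<le> (c / 2) * (13/16)"
      using right_pt_bounds[of "Suc n"] c(1) by (intro mult_mono) linarith+
    then show ?thesis unfolding c(2) left_pt_def target_def c_def[symmetric] using c(1) by linarith
  next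
    case 2
    then have "(1/2 :: real) ^ (k + 4) \<le> (1/2) ^ Suc (visit n + 4)" by (intro power_decreasing) auto
    then have "2 * c \<le> ?d" unfolding c_def power_Suc by linarith
    then have "2 * c * (3/4) \<le> ?d * right_pt (Suc n)"
      using right_pt_bounds[of "Suc n"] by (intro mult_mono) auto
    then show ?thesis unfolding c(2) left_pt_def target_def c_def[symmetric] using c(1) by linarith
  qed
qed

text \<open>The radius is too small to reach \<open>3/4\<close> or \<open>1/2\<close> from the
  target, so \<open>block_orbit\<close> leaves only \<open>left_pt n\<close>, and
  \<open>left_pt_far\<close> then forces \<open>visit n = k\<close>.\<close>

lemma orbit_near_target:
  assumes i: "0 < i" and near: "\<bar>(seed_tent ^^ i) 1 - target k\<bar> < (1/2) ^ (k + 6)"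
  obtains n where "visit n = k" "i \<in> {block_start n..<block_start (Suc n)}"
proof -
  obtain n m where nm: "i = block_start n + m" "m < block_length n" using i by (rule block_exists)
  have p: "(1/2 :: real) ^ (k + 6) \<le> 1/64"
    using power_decreasing[of 6 "k + 6" "1/2 :: real"] by (simp add: eval_nat_numeral)
  have p': "(1/2 :: real) ^ (k + 6) = (1/2) ^ (k + 4) / 4" by (simp add: power_add eval_nat_numeral)
  have "0 < (1/2 :: real) ^ (k + 4)" by simp
  then have "\<not> 3/4 \<le> (seed_tent ^^ i) 1" using near unfolding p' target_def by linarith
  moreover have "\<not> (seed_tent ^^ i) 1 < 1/2" using near p target_bounds[of k] by linarith
  ultimately have "(seed_tent ^^ i) 1 = left_pt n" using block_orbit[OF nm(2)] nm(1) by blast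
  then have "visit n = k" using near left_pt_far[of n k] by fastforce
  with nm show thesis by (intro that[of n]) auto
qed

text \<open>When \<open>visit n = k\<close>, the point \<open>left_pt n\<close> differs from the
  target only through \<open>right_pt (Suc n)\<close> deviating from \<open>3/4\<close>, and this
  deviation \<open>seed (Suc n) / 16\<close> tends to 0.\<close>

lemma target_in_omega_limit:
  assumes "infinite {n. visit n = k}"
  shows "target k \<in> omega_limit seed_tent 1"
  unfolding omega_limit_def
proof (intro CollectI allI impI)
  fix U assume "open U" "target k \<in> U"
  then obtain e where e: "0 < e" "ball (target k) e \<subseteq> U" using open_contains_ball by blast
  obtain N where N: "(1/2 :: real) ^ N < e" using real_arch_pow_inv[of e "1/2"] e(1) by auto
  have "left_pt n \<in> U" if n: "visit n = k" "N \<le> n" for n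
  proof -
    have "\<bar>left_pt n - target k\<bar> = (1/2) ^ (k + 4) * (seed (Suc n) / 16)"
      using n(1) seed_bounds[of "Suc n"]
      by (simp add: left_pt_def right_pt_def target_def algebra_simps)
    also have "\<dots> \<le> 1 * seed (Suc n)"
      using seed_bounds[of "Suc n"] by (intro mult_mono power_le_one) auto
    also have "\<dots> \<le> (1/2) ^ Suc (Suc n) * 1"
      using left_pt_bounds[of "Suc n"] by (subst seed_eq) simp
    also have "\<dots> \<le> (1/2) ^ N" using n(2) power_decreasing[of N "Suc (Suc n)" "1/2 :: real"] by simp
    finally show ?thesis using N e(2) by (auto simp: dist_real_def abs_minus_commute)
  qed
  then have "(\<lambda>n. block_start n + Suc n) ` ({n. visit n = k} - {..<N}) \<subseteq> {i. (seed_tent ^^ i) 1 \<in> U}"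
    by (auto simp: funpow_left_time simp del: funpow.simps add_Suc_right)
  moreover have "inj (\<lambda>n. block_start n + Suc n)"
    using strict_mono_block_start by (intro strict_mono_imp_inj_on) (auto simp: strict_mono_def intro: add_less_mono)
  then have "infinite ((\<lambda>n. block_start n + Suc n) ` ({n. visit n = k} - {..<N}))"
    using assms by (simp add: finite_image_iff inj_on_subset)
  ultimately show "infinite {i. (seed_tent ^^ i) 1 \<in> U}" using infinite_super by blast
qed

text \<open>Finitely many visits fill finitely many blocks, so the orbit enters the open ball of
  radius \<open>(1/2) ^ (k + 6)\<close> only finitely often. The exponent \<open>k + 7\<close> puts
  a closed ball inside this open one.\<close>

lemma target_not_near_omega_limit:
  assumes "finite {n. visit n = k}"
  shows "cball (target k) ((1/2) ^ (k + 7)) \<inter> omega_limit seed_tent 1 = {}"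
proof (rule ccontr)
  assume "\<not> ?thesis"
  then obtain p where p: "p \<in> cball (target k) ((1/2) ^ (k + 7))" "p \<in> omega_limit seed_tent 1" by blast
  have "(1/2 :: real) ^ (k + 7) < (1/2) ^ (k + 6)" by (intro power_strict_decreasing) auto
  with p(1) have "p \<in> ball (target k) ((1/2) ^ (k + 6))"
    unfolding mem_ball mem_cball by linarith
  with p(2) have "infinite {i. (seed_tent ^^ i) 1 \<in> ball (target k) ((1/2) ^ (k + 6))}"
    by (intro omega_limitD) auto
  moreover have "{i. (seed_tent ^^ i) 1 \<in> ball (target k) ((1/2) ^ (k + 6))} \<subseteq>
      insert 0 (\<Union>n\<in>{n. visit n = k}. {block_start n..<block_start (Suc n)})"
  proof
    fix i assume "i \<in> {i. (seed_tent ^^ i) 1 \<in> ball (target k) ((1/2) ^ (k + 6))}"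
    then have "\<bar>(seed_tent ^^ i) 1 - target k\<bar> < (1/2) ^ (k + 6)"
      by (simp add: dist_real_def abs_minus_commute)
    then show "i \<in> insert 0 (\<Union>n\<in>{n. visit n = k}. {block_start n..<block_start (Suc n)})"
      using orbit_near_target[of i k] by (cases "i = 0") blast+
  qed
  moreover have "finite (insert 0 (\<Union>n\<in>{n. visit n = k}. {block_start n..<block_start (Suc n)}))"
    using assms by simp
  ultimately show False using finite_subset by blast
qed

text \<open>Uses \<open>target k = 3 * (2 ^ (k + 4) - 1) / 2 ^ (k + 6)\<close>. The subtractions in
  the denominators undo the \<open>Suc\<close> in the decoding of ideal balls.\<close>

definition target_index :: "nat \<Rightarrow> nat" where
  "target_index k = prod_encode (prod_encode (3 * (2 ^ (k + 4) - 1), 2 ^ (k + 6) - 1),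
     prod_encode (0, 2 ^ (k + 7) - 1))"

lemma ideal_target_index:
  "ideal_center (target_index k) = target k" "ideal_radius (target_index k) = (1/2) ^ (k + 7)"
proof -
  have s: "Suc (2 ^ n - 1) = 2 ^ n" for n :: nat by simp
  have "real (3 * (2 ^ (k + 4) - 1)) / real (Suc (2 ^ (k + 6) - 1)) = target k"
  proof -
    define a where "a = (2 :: real) ^ (k + 4)"
    have "0 < a" "(2 :: real) ^ (k + 6) = 4 * a" "(1/2) ^ (k + 4) = 1 / a"
      by (simp_all add: a_def power_add power_one_over)
    moreover have "real (3 * (2 ^ (k + 4) - 1)) = 3 * (a - 1)"
      by (simp add: a_def of_nat_diff)
    ultimately show ?thesis
      unfolding s target_def of_nat_power of_nat_numeral by (simp add: field_simps)
  qed
  then show "ideal_center (target_index k) = target k"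
    using target_bounds[of k] unfolding ideal_center_def target_index_def
    by (simp del: of_nat_Suc of_nat_mult)
  show "ideal_radius (target_index k) = (1/2) ^ (k + 7)"
    unfolding ideal_radius_def target_index_def
    by (simp add: s power_one_over del: of_nat_Suc)
qed

lemma computable_target_index: "computable (\<lambda>k. target_index (Suc k))"
  unfolding target_index_def by (intro computable_prod_encode computable_intros)

lemma target_index_outer_iff:
  "target_index k \<in> outer_collection (omega_limit seed_tent 1) \<longleftrightarrow> finite {n. visit n = k}"
proof -
  have "ideal_cball (target_index k) = cball (target k) ((1/2) ^ (k + 7)) \<inter> {0..1}"
    by (simp add: ideal_cball_def ideal_target_index)
  moreover have "target k \<in> cball (target k) ((1/2) ^ (k + 7)) \<inter> {0..1}"
    using target_bounds[of k] by simp
  ultimately show ?thesis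
    using target_in_omega_limit[of k] target_not_near_omega_limit[of k]
    unfolding outer_collection_def by blast
qed

section \<open>Computability of the map and of the orbit of 1\<close>

lemma seed_approx_rec: "seed_approx j 0 = rec_nat 0 (\<lambda>i v. backstep (j - Suc i) v) j"
proof -
  \<comment> \<open>The definition of \<open>seed_approx\<close> changes its second argument in the
    recursive call. Applying the maps from the innermost one outwards instead yields a recursion on
    a single value.\<close>
  have "rec_nat 0 (\<lambda>i v. backstep (j - Suc i) v) i = seed_approx i (j - i)" if "i \<le> j" for i
    using that by (induction i) (auto simp: Suc_diff_Suc)
  then show ?thesis by simp
qed

lemma qcomputable_seed_approx:
  assumes "computable J"
  shows "qcomputable (\<lambda>t. seed_approx (J t) 0)"
  unfolding seed_approx_rec
  by (rule qcomputable_rec_nat[where H = "\<lambda>i v t. backstep (J t - Suc i) v"], rule assms, rule qcomputable_0,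
    unfold backstep_def,
    intro qcomputable_intros computable_intros computable_compose[OF computable_visit]
      computable_compose[OF assms])

lemma qcomputable_tent:
  "qcomputable Z \<Longrightarrow> qcomputable X \<Longrightarrow> qcomputable (\<lambda>t. tent (Z t) (X t))"
  unfolding tent_def by (intro qcomputable_intros)

lemma quarter_le_half: "(1/4 :: real) ^ j \<le> (1/2) ^ j"
  by (intro power_mono) auto

lemma computable_seed_tent: "computable_map seed_tent"
proof (rule computable_map_if_Lipschitz[where L = 16 and g = "\<lambda>j. tent (seed_approx j 0)"])
  show "qcomputable (\<lambda>t. tent (seed_approx (fst t) 0) (ideal_center (snd t)))"
    by (intro qcomputable_tent qcomputable_seed_approx qcomputable_ideal_center computable_intros)
  show "\<bar>tent (seed_approx j 0) x - seed_tent x\<bar> \<le> (1/2) ^ j" for j x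
    using tent_perturb[of "seed_approx j 0" x "seed 0"] seed_approx_error[of 0 j] quarter_le_half[of j]
    by linarith
qed (use tent_maps seed_bounds tent_Lipschitz in auto)

lemma Sigma_set_2_outer_seed_tent: "Sigma_set 2 (outer_collection (omega_limit seed_tent 1))"
proof (rule Sigma_set_2_outer_omega_limit)
  show "(seed_tent ^^ n) 1 \<in> {0..1}" for n
    using tent_funpow_maps seed_bounds by simp
  \<comment> \<open>Index \<open>3 * n\<close> gives the parameter an error of at most
    \<open>(1/64) ^ n\<close>, which outweighs the growth \<open>17 ^ n\<close> of the perturbation,
    as \<open>17/64 < 1/2\<close>.\<close>
  show "qcomputable (\<lambda>n. rec_nat 1 (\<lambda>i v. tent (seed_approx (3 * n) 0) v) n)"
    by (rule qcomputable_rec_nat[where H = "\<lambda>i v n. tent (seed_approx (3 * n) 0) v"])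
      (intro qcomputable_tent qcomputable_seed_approx qcomputable_intros computable_intros)+
  show "\<bar>rec_nat 1 (\<lambda>i v. tent (seed_approx (3 * n) 0) v) n - (seed_tent ^^ n) 1\<bar> \<le> (1/2) ^ n" for n
  proof -
    have "rec_nat 1 (\<lambda>i v. tent z v) m = (tent z ^^ m) 1" for z m
      by (induction m) auto
    then have "\<bar>rec_nat 1 (\<lambda>i v. tent (seed_approx (3 * n) 0) v) n - (seed_tent ^^ n) 1\<bar> \<le>
        17 ^ n * \<bar>seed_approx (3 * n) 0 - seed 0\<bar>"
      using tent_funpow_perturb by simp
    also have "\<dots> \<le> 17 ^ n * (1/4) ^ (3 * n)"
      using seed_approx_error[of 0 "3 * n"] by (intro mult_left_mono) (auto simp: abs_minus_commute)
    also have "\<dots> = (17/64) ^ n"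
      unfolding power_mult power_mult_distrib[symmetric] by (simp add: power3_eq_cube)
    also have "\<dots> \<le> (1/2) ^ n" by (intro power_mono) auto
    finally show ?thesis .
  qed
qed

section \<open>The limit set of 1 as metric attractor\<close>

lemma omega_limit_eq_if_not_avoiding:
  assumes "x \<in> {0..1}" "x \<notin> avoiding z"
  shows "omega_limit (tent z) x = omega_limit (tent z) 1"
proof -
  from assms obtain n where "(tent z ^^ n) x = 1" unfolding avoiding_def by blast
  then show ?thesis using omega_limit_funpow[of "tent z" n x] by simp
qed

text \<open>Outside the null set \<open>avoiding z\<close> every limit set equals that of 1. Hence
  the basin of the latter has full measure, while a proper subset of it can only attract points of
  \<open>avoiding z\<close>.\<close>

lemma metric_attractor_tent:
  assumes z: "0 \<le> z"
  shows "metric_attractor (tent z) (omega_limit (tent z) 1)"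
  unfolding metric_attractor_def
proof (intro conjI notI)
  let ?A = "omega_limit (tent z) 1"
  show "closed ?A" by (rule closed_omega_limit)
  show "?A \<subseteq> {0..1}" using tent_funpow_maps[OF z] by (intro omega_limit_subset) auto
  \<comment> \<open>Completeness of Lebesgue measure makes arbitrary subsets measurable here, so no
    basin has to be shown Borel.\<close>
  have null: "B \<in> null_sets lebesgue" if "B \<subseteq> avoiding z" for B
    using that avoiding_null[OF z] by (rule null_sets_completion_subset)
  have restrict: "emeasure (lebesgue_on {0..1}) B = emeasure lebesgue B" if "B \<subseteq> {0..1}" for B :: "real set"
    using that by (intro emeasure_restrict_space) auto
  have "basin (tent z) ?A = {0..1} - (avoiding z - basin (tent z) ?A)"
    using omega_limit_eq_if_not_avoiding unfolding basin_def avoiding_def by fastforce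
  then have "emeasure (lebesgue_on {0..1}) (basin (tent z) ?A) =
      emeasure lebesgue ({0..1} - (avoiding z - basin (tent z) ?A))"
    using restrict[of "{0..1} - (avoiding z - basin (tent z) ?A)"] by auto
  also have "\<dots> = emeasure lebesgue {0..1::real}"
    by (intro emeasure_Diff_null_set null) auto
  finally show "emeasure (lebesgue_on {0..1}) (basin (tent z) ?A) = 1" by simp
  assume "\<exists>A'. closed A' \<and> A' \<subset> ?A \<and> 0 < emeasure (lebesgue_on {0..1}) (basin (tent z) A')"
  then obtain A' where A': "A' \<subset> ?A" "0 < emeasure (lebesgue_on {0..1}) (basin (tent z) A')" by blast
  have "basin (tent z) A' \<subseteq> avoiding z"
    using A'(1) omega_limit_eq_if_not_avoiding unfolding basin_def by blast
  then have "emeasure lebesgue (basin (tent z) A') = 0" using null by blast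
  moreover have "basin (tent z) A' \<subseteq> {0..1}" unfolding basin_def by blast
  ultimately show False using A'(2) restrict by simp
qed

theorem corollary2:
  "\<exists>(f :: real \<Rightarrow> real) (A :: real set).
     computable_map f \<and> metric_attractor f A \<and> Pi_complete 2 A"
proof (intro exI conjI)
  show "computable_map seed_tent" by (rule computable_seed_tent)
  show att: "metric_attractor seed_tent (omega_limit seed_tent 1)"
    using seed_bounds(1) by (rule metric_attractor_tent)
  have A: "closed (omega_limit seed_tent 1)" "omega_limit seed_tent 1 \<subseteq> {0..1}"
    using att unfolding metric_attractor_def by blast+
  then have "compact (omega_limit seed_tent 1)"
    using closed_Int_compact[OF A(1), of "{0..1}"] by (simp add: Int_absorb2)
  then have "Pi_compact 2 (omega_limit seed_tent 1)"
    using A(2) Sigma_set_2_outer_seed_tent unfolding Pi_compact_def by blast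
  moreover have "outer_reducible K' (omega_limit seed_tent 1)" if "Pi_compact 2 K'" for K'
    \<comment> \<open>The targets are taken at \<open>Suc k\<close> because \<open>visit\<close>
      reserves 0 for idle steps.\<close>
    using computable_target_index target_index_outer_iff that by (rule outer_reducible_if_visit)
  ultimately show "Pi_complete 2 (omega_limit seed_tent 1)" unfolding Pi_complete_def by blast
qed

end
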